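(* For every integer $d \ge 1$ and every $\alpha \in (0,1]$ there exists $C>0$, depending on $d$ and $\alpha$ only, such that the following holds: for any $\rho : (0,1)^d \to (0,\infty)$ with $$\int_{(0,1)^d} \rho = 1 \quad \text{and} \quad \|\rho - 1\|_{C^\alpha} \le \frac 1 2,$$ there exists an invertible map $T : (0,1)^d \to (0,1)^d$ such that $T_\sharp \rho = 1$, with $$\operatorname{Lip} T,\ \operatorname{Lip} T^{-1} \le 1 + C\|\rho-1\|_{C^\alpha} \quad \text{and} \quad T(\partial (0,1)^d) = \partial (0,1)^d.$$
   Context: For $f:\Omega\to\mathbb{R}$, $\|f\|_{C^\alpha(\Omega)} = \sup_{x\in\Omega}|f(x)| + \sup_{x\neq y\in\Omega} \frac{|f(y)-f(x)|}{|x-y|^\alpha}$; here $\Omega=(0,1)^d$. For a map $f$ on $\Omega$, $\operatorname{Lip} f = \sup_{x\ne y\in\Omega} \frac{|f(y)-f(x)|}{|x-y|}$. $T_\sharp\rho$ denotes the push-forward under $T$ of the measure with Lebesgue density $\rho$, and $T_\sharp\rho = 1$ means that it is Lebesgue measure on $(0,1)^d$. In the last assertion, $T$ is understood as extended by (Lipschitz) continuity to the closed cube $[0,1]^d$. *)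

theory Defs
  imports "HOL-Analysis.Analysis"
begin

abbreviation open_cube :: "(real ^ 'n) set" where
  "open_cube \<equiv> box 0 1"

text \<open>Both suprema are taken in the extended nonnegative reals, so that they are infinite
  (and not unspecified) when the function is unbounded or not Hoelder, respectively Lipschitz,
  continuous on \<open>S\<close>. Values of the function outside \<open>S\<close> are irrelevant.\<close>

definition holder_norm :: "real \<Rightarrow> 'a::metric_space set \<Rightarrow> ('a \<Rightarrow> real) \<Rightarrow> ennreal" where
  "holder_norm \<alpha> S f =
     (SUP x\<in>S. ennreal \<bar>f x\<bar>) +
     (SUP (x, y)\<in>{(x, y). x \<in> S \<and> y \<in> S \<and> x \<noteq> y}.
        ennreal (\<bar>f y - f x\<bar> / dist x y powr \<alpha>))"

definition Lip :: "'a::metric_space set \<Rightarrow> ('a \<Rightarrow> 'b::metric_space) \<Rightarrow> ennreal" where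
  "Lip S f =
     (SUP (x, y)\<in>{(x, y). x \<in> S \<and> y \<in> S \<and> x \<noteq> y}.
        ennreal (dist (f x) (f y) / dist x y))"

text \<open>The measure with Lebesgue density \<open>\<rho>\<close> on \<open>S\<close>, on the Borel subsets of \<open>S\<close>.\<close>

definition density_measure :: "(real ^ 'n) set \<Rightarrow> (real ^ 'n \<Rightarrow> real) \<Rightarrow> (real ^ 'n) measure" where
  "density_measure S \<rho> = density (restrict_space lborel S) (\<lambda>x. ennreal (\<rho> x))"

end

theory Submission
  imports Defs
begin

text \<open>The map is built scale by scale. Extend \<open>\<rho>\<close> from the cube to the whole space by reflections, so
  that it becomes even and 2-periodic in every coordinate, and let \<open>\<rho>\<^sub>k\<close> be its averages over cubes of
  half-side \<open>r = (1/2)^k\<close>; then \<open>\<rho>\<^sub>0\<close> is constant and \<open>\<rho>\<^sub>k\<close> tends to \<open>\<rho>\<close>. Averaging one coordinate at a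
  time, one passes from the half-side \<open>r/2\<close> to \<open>r\<close> in \<open>d\<close> steps. Each step preserves the mass of the
  unit segments in one coordinate direction, hence is realised by the monotone rearrangement along
  that direction. The densities have Lipschitz constant of order \<open>\<delta> r powr (\<alpha> - 1)\<close>, where \<open>\<delta>\<close> is the
  Hoelder norm of \<open>\<rho> - 1\<close>, while mass moves only by a distance of order \<open>\<delta> r\<close>; therefore the
  rearrangement and its inverse have Lipschitz constant at most \<open>exp (C \<delta> r powr \<alpha>)\<close>. Over all scales
  these factors multiply to \<open>exp (C' \<delta>)\<close>, and the compositions converge to \<open>T\<close>.\<close>

section \<open>Primitives and averages on the line\<close>

text \<open>One rearrangement taking \<rho> directly to 1 need not be Lipschitz: its variation
  across the lines involves transverse derivatives of the line primitives of \<rho>, and \<rho> is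
  only Hoelder. So in each step every coordinate except the active one, b, has already been
  averaged. Let f be this density, not yet averaged along b, let F be its line primitive and P, Q
  those of its two b-averages. Averaging commutes with taking primitives, so P and Q evaluate F only
  within distance r, and transverse increments of P - F and Q - F gain a factor r over those of f.
  Transversally this leaves \<delta> r^\<alpha>, the same order as the difference of the two
  averages along b. Summing the geometric series of the r^\<alpha> produces the factor 1 / (1 -
  (1/2) powr \<alpha>) in the exponent. The reflections serve two ends. Averages never meet a
  boundary, and evenness about 0 and about 1 makes P and Q agree on the two faces orthogonal to b,
  so that faces are preserved exactly and not merely up to an error.\<close>

definition prim :: "(real \<Rightarrow> real) \<Rightarrow> real \<Rightarrow> real" where
  "prim f t = integral {0..t} f - integral {t..0} f"

text \<open>Written through the primitive, so that its derivative is a difference quotient of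
  \<open>f\<close> and the mean value theorem applies at once.\<close>

definition avg1 :: "real \<Rightarrow> (real \<Rightarrow> real) \<Rightarrow> real \<Rightarrow> real" where
  "avg1 r f s = (prim f (s + r) - prim f (s - r)) / (2 * r)"

lemma prim_0 [simp]: "prim f 0 = 0"
  by (simp add: prim_def)

lemma integral_eq_antideriv:
  fixes F :: "real \<Rightarrow> real"
  assumes "\<And>x. (F has_real_derivative f x) (at x)" and "a \<le> b"
  shows "integral {a..b} f = F b - F a"
  by (rule integral_unique, rule fundamental_theorem_of_calculus)
    (use assms in \<open>auto intro: has_field_derivative_at_within
      simp flip: has_real_derivative_iff_has_vector_derivative\<close>)

lemma prim_unique:
  fixes F :: "real \<Rightarrow> real"
  assumes "\<And>x. (F has_real_derivative f x) (at x)"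
  shows "prim f t = F t - F 0"
proof (cases "t \<ge> 0")
  case True
  then have "integral {t..0} f = 0"
    by (cases "t = 0") auto
  with True show ?thesis
    by (simp add: prim_def integral_eq_antideriv[OF assms])
next
  case False
  then show ?thesis
    by (simp add: prim_def integral_eq_antideriv[OF assms])
qed

lemma DERIV_prim:
  assumes "continuous_on UNIV f"
  shows "(prim f has_real_derivative f t) (at t)"
proof -
  define a where "a = min 0 t - 1"
  define b where "b = max 0 t + 1"
  have int: "f integrable_on {c..d}" for c d
    using assms continuous_on_subset integrable_continuous_real by blast
  have eq: "prim f s = integral {a..s} f - integral {a..0} f" if "s \<in> {a<..<b}" for s
  proof (cases "s \<ge> 0")
    case True
    have "integral {a..0} f + integral {0..s} f = integral {a..s} f"
      by (rule Henstock_Kurzweil_Integration.integral_combine) (use True int in \<open>auto simp: a_def\<close>)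
    moreover have "integral {s..0} f = 0"
      using True by (cases "s = 0") auto
    ultimately show ?thesis by (simp add: prim_def)
  next
    case False
    have "integral {a..s} f + integral {s..0} f = integral {a..0} f"
      by (rule Henstock_Kurzweil_Integration.integral_combine) (use False that int in auto)
    with False show ?thesis by (simp add: prim_def)
  qed
  have t: "t \<in> {a<..<b}"
    by (auto simp: a_def b_def)
  have "((\<lambda>s. integral {a..s} f) has_real_derivative f t) (at t within {a..b})"
    by (rule integral_has_real_derivative) (use assms continuous_on_subset t in auto)
  then have "((\<lambda>s. integral {a..s} f) has_real_derivative f t) (at t)"
    using t at_within_Icc_at[of a t b] by auto
  then have "((\<lambda>s. integral {a..s} f - integral {a..0} f) has_real_derivative f t) (at t)"
    by (auto intro!: derivative_eq_intros)
  then show ?thesis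
    by (rule has_field_derivative_transform_within_open[where S="{a<..<b}"]) (use t eq in auto)
qed

lemma DERIV_prim_chain [derivative_intros]:
  assumes "continuous_on UNIV f" and "(g has_real_derivative g') (at x)"
  shows "((\<lambda>x. prim f (g x)) has_real_derivative f (g x) * g') (at x)"
  using DERIV_chain2[OF DERIV_prim assms(2)] assms(1) by blast

lemma continuous_on_prim [continuous_intros]:
  "continuous_on UNIV f \<Longrightarrow> continuous_on UNIV (prim f)"
  by (meson DERIV_prim DERIV_isCont continuous_at_imp_continuous_on)

lemma integral_eq_prim:
  assumes "continuous_on UNIV f" and "a \<le> b"
  shows "integral {a..b} f = prim f b - prim f a"
  using assms DERIV_prim integral_eq_antideriv by blast

lemma prim_odd:
  assumes "continuous_on UNIV f" and "\<And>t. f (- t) = f t"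
  shows "prim f (- t) = - prim f t"
proof -
  have "((\<lambda>x. - prim f (- x)) has_real_derivative f t) (at t)" for t
    by (rule derivative_eq_intros refl assms)+ (simp add: assms)
  then show ?thesis
    by (subst (2) prim_unique[where F="\<lambda>x. - prim f (- x)"]) simp_all
qed

lemma prim_even:
  assumes "continuous_on UNIV f" and "\<And>t. f (- t) = - f t"
  shows "prim f (- t) = prim f t"
proof -
  have "((\<lambda>x. prim f (- x)) has_real_derivative f t) (at t)" for t
    by (rule derivative_eq_intros refl assms)+ (simp add: assms)
  then show ?thesis
    by (subst (2) prim_unique[where F="\<lambda>x. prim f (- x)"]) simp_all
qed

lemma prim_shift:
  assumes "continuous_on UNIV f"
  shows "prim (\<lambda>t. f (s + t)) u = prim f (s + u) - prim f s"
proof -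
  have "((\<lambda>x. prim f (s + x)) has_real_derivative f (s + t)) (at t)" for t
    by (rule derivative_eq_intros refl assms)+ simp
  then show ?thesis
    by (subst prim_unique[where F="\<lambda>x. prim f (s + x)"]) simp_all
qed

lemma prim_diff:
  assumes "continuous_on UNIV f" "continuous_on UNIV g"
  shows "prim (\<lambda>t. f t - g t) u = prim f u - prim g u"
proof -
  have "((\<lambda>x. prim f x - prim g x) has_real_derivative f t - g t) (at t)" for t
    by (rule derivative_eq_intros refl assms)+ simp
  then show ?thesis
    by (subst prim_unique[where F="\<lambda>x. prim f x - prim g x"]) simp_all
qed

lemma prim_const: "prim (\<lambda>t. c) u = c * u"
  by (subst prim_unique[where F="\<lambda>x. c * x"]) (auto intro!: derivative_eq_intros)

lemma DERIV_avg1: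
  assumes "continuous_on UNIV f" "r > 0"
  shows "(avg1 r f has_real_derivative (f (s + r) - f (s - r)) / (2 * r)) (at s)"
  unfolding avg1_def[abs_def]
  by (rule derivative_eq_intros refl assms)+ (use assms in \<open>auto simp: field_simps\<close>)

lemma continuous_avg1:
  "continuous_on UNIV f \<Longrightarrow> r > 0 \<Longrightarrow> continuous_on UNIV (avg1 r f)"
  by (meson DERIV_avg1 DERIV_isCont continuous_at_imp_continuous_on)

lemma avg1_diff:
  assumes "continuous_on UNIV f" "continuous_on UNIV g"
  shows "avg1 r (\<lambda>t. f t - g t) u = avg1 r f u - avg1 r g u"
  unfolding avg1_def prim_diff[OF assms] by (simp add: diff_divide_distrib)

lemma avg1_const: "r > 0 \<Longrightarrow> avg1 r (\<lambda>t. c) u = c"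
  by (simp add: avg1_def prim_const algebra_simps)

lemma avg1_shift:
  assumes "continuous_on UNIV f"
  shows "avg1 r (\<lambda>t. f (s + t)) u = avg1 r f (s + u)"
  unfolding avg1_def prim_shift[OF assms] by (simp add: algebra_simps)

lemma avg1_mean_value:
  assumes "continuous_on UNIV f" "r > 0"
  obtains \<xi> where "\<bar>\<xi> - s\<bar> < r" "avg1 r f s = f \<xi>"
proof -
  have "\<exists>z>s - r. z < s + r \<and> prim f (s + r) - prim f (s - r) = ((s + r) - (s - r)) * f z"
    by (rule MVT2) (use assms DERIV_prim in auto)
  then obtain z where "z > s - r" "z < s + r" "prim f (s + r) - prim f (s - r) = 2 * r * f z"
    by auto
  with assms that[of z] show ?thesis
    by (auto simp: avg1_def)
qed

lemma DERIV_abs_diff_le: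
  fixes F :: "real \<Rightarrow> real"
  assumes "\<And>x. (F has_real_derivative f x) (at x)" "\<And>x. \<bar>f x\<bar> \<le> m"
  shows "\<bar>F b - F a\<bar> \<le> m * \<bar>b - a\<bar>"
proof -
  have *: "\<bar>F b - F a\<bar> \<le> m * \<bar>b - a\<bar>" if ab: "a < b" for a b
  proof -
    obtain z where "F b - F a = (b - a) * f z"
      using MVT2[OF ab, of F f] assms(1) by metis
    with assms(2)[of z] ab show ?thesis
      by (auto simp: abs_mult intro: mult_left_mono)
  qed
  then show ?thesis
    by (metis abs_minus_commute abs_zero diff_self linorder_less_linear mult_zero_right order_refl)
qed

text \<open>Both sides have derivative \<open>avg1 r f\<close>, so they differ by a constant. It
  vanishes by parity: \<open>prim f\<close> is odd, its primitive is even, and hence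
  \<open>avg1 r (prim f) 0 = 0\<close>.\<close>

lemma prim_avg1:
  assumes f: "continuous_on UNIV f" and even: "\<And>t. f (- t) = f t" and r: "r > 0"
  shows "prim (avg1 r f) s = avg1 r (prim f) s"
proof -
  note pf = continuous_on_prim[OF f]
  have "(avg1 r (prim f) has_real_derivative avg1 r f t) (at t)" for t
    using DERIV_avg1[OF pf r, of t] unfolding avg1_def[of r f] .
  then have "prim (avg1 r f) s = avg1 r (prim f) s - avg1 r (prim f) 0"
    by (rule prim_unique)
  then show ?thesis
    using prim_even[OF pf prim_odd[OF f even], of r] by (simp add: avg1_def)
qed

text \<open>By \<open>prim_avg1\<close> the first primitive is a window average of
  \<open>prim f\<close>, hence a value of \<open>prim f\<close> within distance \<open>r\<close> of
  \<open>s\<close>. This is the gain of a factor \<open>r\<close>.\<close>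

lemma avg1_close_prim:
  assumes f: "continuous_on UNIV f" and even: "\<And>t. f (- t) = f t" and m: "\<And>t. \<bar>f t\<bar> \<le> m" and r: "r > 0"
  shows "\<bar>prim (avg1 r f) s - prim f s\<bar> \<le> m * r"
proof -
  note pf = continuous_on_prim[OF f]
  have "prim (avg1 r f) s = avg1 r (prim f) s"
    using f even r by (rule prim_avg1)
  moreover obtain \<xi> where \<xi>: "\<bar>\<xi> - s\<bar> < r" "avg1 r (prim f) s = prim f \<xi>"
    using avg1_mean_value[OF pf r] .
  moreover have "\<bar>prim f \<xi> - prim f s\<bar> \<le> m * \<bar>\<xi> - s\<bar>"
    by (rule DERIV_abs_diff_le) (use f m DERIV_prim in auto)
  moreover have "m * \<bar>\<xi> - s\<bar> \<le> m * r"
    using \<xi> m[of 0] by (intro mult_left_mono) auto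
  ultimately show ?thesis by simp
qed

text \<open>Mass conservation on the unit segment: \<open>f\<close> is even about 1 as well, so
  \<open>prim f\<close> minus its value at 1 is odd about 1 and averages to 0 there.\<close>

lemma prim_avg1_1:
  assumes f: "continuous_on UNIV f" and even: "\<And>t. f (- t) = f t"
    and per: "\<And>t. f (t + 2) = f t" and r: "r > 0"
  shows "prim (avg1 r f) 1 = prim f 1"
proof -
  note pf = continuous_on_prim[OF f]
  have "prim (avg1 r f) 1 = avg1 r (prim f) 1"
    using f even r by (rule prim_avg1)
  moreover have "avg1 r (prim f) 1 = prim f 1"
  proof -
    have sym: "f (1 - t) = f (1 + t)" for t
      using even[of "1 - t"] per[of "t - 1"] by (simp add: algebra_simps)
    have "((\<lambda>t. prim f (1 + t) + prim f (1 - t)) has_real_derivative 0) (at t)" for t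
      by (rule derivative_eq_intros refl f)+ (simp add: sym)
    then have c: "prim f (1 + t) + prim f (1 - t) = prim f (1 + 0) + prim f (1 - 0)" for t
      by (rule DERIV_isconst_all[rule_format])
    \<comment> \<open>The relation \<open>c\<close>, integrated once more in \<open>t\<close>; at
      \<open>t = r\<close> it yields the average about 1.\<close>
    have "((\<lambda>t. prim (prim f) (1 + t) - prim (prim f) (1 - t) - 2 * prim f 1 * t) has_real_derivative 0) (at t)" for t
      by (rule derivative_eq_intros refl pf)+ (use c[of t] in simp)
    then have "prim (prim f) (1 + r) - prim (prim f) (1 - r) - 2 * prim f 1 * r
        = prim (prim f) (1 + 0) - prim (prim f) (1 - 0) - 2 * prim f 1 * 0"
      by (rule DERIV_isconst_all[rule_format])
    with r show ?thesis by (simp add: avg1_def)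
  qed
  ultimately show ?thesis by simp
qed

section \<open>Averages along a coordinate direction\<close>

definition avg :: "real \<Rightarrow> 'a::euclidean_space \<Rightarrow> ('a \<Rightarrow> real) \<Rightarrow> 'a \<Rightarrow> real" where
  "avg r b f x = avg1 r (\<lambda>t. f (x + t *\<^sub>R b)) 0"

text \<open>Sup norm and Hoelder seminorm of \<open>f - 1\<close> are bounded separately by the same
  \<delta>. The seminorm is phrased with increments \<open>v\<close> because averages commute with
  translations.\<close>

definition holder_near_1 :: "real \<Rightarrow> real \<Rightarrow> ('a::real_normed_vector \<Rightarrow> real) \<Rightarrow> bool" where
  "holder_near_1 \<delta> \<alpha> f \<longleftrightarrow>
     (\<forall>x. \<bar>f x - 1\<bar> \<le> \<delta>) \<and> (\<forall>x v. \<bar>f (x + v) - f x\<bar> \<le> \<delta> * norm v powr \<alpha>)"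

lemma holder_near_1_continuous:
  assumes "holder_near_1 \<delta> \<alpha> f" "0 < \<alpha>"
  shows "continuous_on S f"
proof -
  have "isCont f x" for x
  proof -
    have "((\<lambda>y. norm (y - x)) \<longlongrightarrow> 0) (at x)"
      using LIM_zero tendsto_ident_at tendsto_norm_zero by blast
    then have "((\<lambda>y. norm (y - x) powr \<alpha>) \<longlongrightarrow> 0) (at x)"
      by (rule tendsto_zero_powrI[OF _ tendsto_const]) (use assms in auto)
    then have lim: "((\<lambda>y. \<delta> * norm (y - x) powr \<alpha>) \<longlongrightarrow> 0) (at x)"
      by (rule tendsto_mult_right_zero)
    have "norm (f y - f x) \<le> \<delta> * norm (y - x) powr \<alpha>" for y
    proof -
      have "\<bar>f (x + (y - x)) - f x\<bar> \<le> \<delta> * norm (y - x) powr \<alpha>"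
        using assms(1) unfolding holder_near_1_def by blast
      then show ?thesis by simp
    qed
    then have "((\<lambda>y. f y - f x) \<longlongrightarrow> 0) (at x)"
      by (rule Lim_null_comparison[OF always_eventually[OF allI] lim])
    then show ?thesis
      by (simp add: isCont_def LIM_zero_iff)
  qed
  then show ?thesis
    by (simp add: continuous_at_imp_continuous_on)
qed

lemma continuous_on_line:
  fixes f :: "'a::real_normed_vector \<Rightarrow> real"
  assumes "continuous_on UNIV f"
  shows "continuous_on S (\<lambda>t. f (x + t *\<^sub>R b))" "continuous_on S (\<lambda>t. f (x + (t - c) *\<^sub>R b))"
  by (intro continuous_on_compose2[OF assms] continuous_intros subset_UNIV)+

lemma avg_mean_value:
  assumes "continuous_on UNIV f" "r > 0"
  obtains t where "\<bar>t\<bar> < r" "avg r b f x = f (x + t *\<^sub>R b)"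
  using avg1_mean_value[OF continuous_on_line(1)[OF assms(1)] assms(2), of 0 x b]
  unfolding avg_def by auto

text \<open>The difference of the two averages is the average of the translated difference. Applied
  to Hoelder bounds, to Lipschitz bounds in other directions and, with \<open>K = 0\<close>, to
  periodicity.\<close>

lemma avg_increment_le:
  assumes f: "continuous_on UNIV f" and r: "r > 0" and K: "\<And>x. \<bar>f (x + v) - f x\<bar> \<le> K"
  shows "\<bar>avg r b f (x + v) - avg r b f x\<bar> \<le> K"
proof -
  let ?g = "\<lambda>t. f (x + v + t *\<^sub>R b) - f (x + t *\<^sub>R b)"
  have g: "continuous_on UNIV ?g"
    by (intro continuous_on_diff continuous_on_line f)
  obtain t where "avg1 r ?g 0 = ?g t"
    by (rule avg1_mean_value[OF g r])
  moreover have "avg1 r ?g 0 = avg r b f (x + v) - avg r b f x"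
    unfolding avg_def by (rule avg1_diff) (intro continuous_on_line f)+
  moreover have "\<bar>?g t\<bar> \<le> K"
    using K[of "x + t *\<^sub>R b"] by (simp add: algebra_simps)
  ultimately show ?thesis by simp
qed

lemma holder_near_1_avg:
  assumes f: "holder_near_1 \<delta> \<alpha> f" and "0 < \<alpha>" "0 < r"
  shows "holder_near_1 \<delta> \<alpha> (avg r b f)"
  unfolding holder_near_1_def
proof (intro conjI allI)
  note c = holder_near_1_continuous[OF assms(1,2)]
  show "\<bar>avg r b f x - 1\<bar> \<le> \<delta>" for x
  proof -
    obtain t where "avg r b f x = f (x + t *\<^sub>R b)"
      by (rule avg_mean_value[OF c assms(3)])
    with f show ?thesis
      by (simp add: holder_near_1_def)
  qed
  show "\<bar>avg r b f (x + v) - avg r b f x\<bar> \<le> \<delta> * norm v powr \<alpha>" for x v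
    by (rule avg_increment_le[OF c assms(3)]) (use f in \<open>simp add: holder_near_1_def\<close>)
qed

lemma avg_along_line:
  assumes "continuous_on UNIV f"
  shows "avg r b f (x + s *\<^sub>R b) = avg1 r (\<lambda>t. f (x + t *\<^sub>R b)) s"
  using avg1_shift[OF continuous_on_line(1)[OF assms], where r=r and s=s and u=0]
  unfolding avg_def by (simp add: scaleR_add_left add.assoc)

text \<open>Here regularity is gained: along \<open>b\<close> the average has as derivative the
  increment of \<open>f\<close> across the window divided by \<open>2 * r\<close>. A Hoelder bound
  thus becomes the Lipschitz constant \<delta> (2 r)^(\<alpha> - 1).\<close>

lemma avg_direction_le:
  assumes f: "continuous_on UNIV f" and r: "r > 0" and K: "\<And>x. \<bar>f (x + (2 * r) *\<^sub>R b) - f x\<bar> \<le> K"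
  shows "\<bar>avg r b f (x + h *\<^sub>R b) - avg r b f x\<bar> \<le> K / (2 * r) * \<bar>h\<bar>"
proof -
  let ?\<phi> = "\<lambda>t. f (x + t *\<^sub>R b)"
  have "\<bar>avg1 r ?\<phi> h - avg1 r ?\<phi> 0\<bar> \<le> K / (2 * r) * \<bar>h - 0\<bar>"
  proof (rule DERIV_abs_diff_le)
    fix s
    show "(avg1 r ?\<phi> has_real_derivative (?\<phi> (s + r) - ?\<phi> (s - r)) / (2 * r)) (at s)"
      by (rule DERIV_avg1) (use continuous_on_line f r in auto)
    have "\<bar>?\<phi> (s + r) - ?\<phi> (s - r)\<bar> \<le> K"
    proof -
      have "x + (s - r) *\<^sub>R b + (2 * r) *\<^sub>R b = x + (s + r) *\<^sub>R b"
        by (simp add: add.assoc flip: scaleR_add_left)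
      then show ?thesis
        using K[of "x + (s - r) *\<^sub>R b"] by metis
    qed
    with r show "\<bar>(?\<phi> (s + r) - ?\<phi> (s - r)) / (2 * r)\<bar> \<le> K / (2 * r)"
      by (simp add: divide_right_mono)
  qed
  then show ?thesis
    using avg_along_line[OF f, of r b x h] avg_along_line[OF f, of r b x 0] by simp
qed

lemma avg_eq_integral:
  assumes "continuous_on UNIV f" "r > 0"
  shows "avg r b f x = integral {- r..r} (\<lambda>t. f (x + t *\<^sub>R b)) / (2 * r)"
  unfolding avg_def avg1_def using assms
  by (subst integral_eq_prim) (auto intro: continuous_on_line)

text \<open>Fubini on a rectangle. It allows the one average whose scale is being changed to be
  pulled outside all the others.\<close>

lemma avg_commute:
  assumes f: "holder_near_1 \<delta> \<alpha> f" and "0 < \<alpha>" "0 < r" "0 < s"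
  shows "avg r b (avg s c f) = avg s c (avg r b f)"
proof
  fix x
  note c = holder_near_1_continuous[OF f \<open>0 < \<alpha>\<close>]
  have cont: "continuous_on UNIV (avg s b f)" if "0 < s" for s b
    using holder_near_1_continuous[OF holder_near_1_avg[OF assms(1,2) that] assms(2)] .
  have "integral (cbox (-r) r) (\<lambda>t. integral (cbox (-s) s) (\<lambda>u. f (x + t *\<^sub>R b + u *\<^sub>R c)))
      = integral (cbox (-s) s) (\<lambda>u. integral (cbox (-r) r) (\<lambda>t. f (x + t *\<^sub>R b + u *\<^sub>R c)))"
    by (rule integral_swap_continuous)
      (auto simp: case_prod_unfold intro!: continuous_on_compose2[OF c[of UNIV]] continuous_intros)
  moreover have e: "x + u *\<^sub>R c + t *\<^sub>R b = x + t *\<^sub>R b + u *\<^sub>R c" for t u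
    by simp
  ultimately show "avg r b (avg s c f) x = avg s c (avg r b f) x"
    using assms(3,4) by (simp add: avg_eq_integral[OF c] avg_eq_integral[OF cont] mult.commute e)
qed

lemma avg_reflection:
  assumes f: "continuous_on UNIV f" and r: "r > 0" and "b \<in> Basis" "c \<in> Basis" "b \<noteq> c"
    and "\<And>x. f (x - (2 * (x \<bullet> b)) *\<^sub>R b) = f x"
  shows "avg r c f (x - (2 * (x \<bullet> b)) *\<^sub>R b) = avg r c f x"
proof -
  have "f (x - (2 * (x \<bullet> b)) *\<^sub>R b + t *\<^sub>R c) = f (x + t *\<^sub>R c)" for t
  proof -
    have "(x + t *\<^sub>R c) \<bullet> b = x \<bullet> b"
      using assms(3-5) by (simp add: inner_left_distrib inner_not_same_Basis)
    moreover have "x - (2 * (x \<bullet> b)) *\<^sub>R b + t *\<^sub>R c = x + t *\<^sub>R c - (2 * (x \<bullet> b)) *\<^sub>R b"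
      by simp
    ultimately show ?thesis
      using assms(6)[of "x + t *\<^sub>R c"] by metis
  qed
  then show ?thesis by (simp add: avg_def)
qed

section \<open>Iterated averages over a list of coordinates\<close>

lemma holder_near_1_foldr:
  assumes "holder_near_1 \<delta> \<alpha> f" "0 < \<alpha>" "0 < r"
  shows "holder_near_1 \<delta> \<alpha> (foldr (avg r) bs f)"
  by (induction bs) (use assms holder_near_1_avg in auto)

lemma foldr_avg_commute:
  assumes "holder_near_1 \<delta> \<alpha> f" "0 < \<alpha>" "0 < r" "0 < s"
  shows "avg s c (foldr (avg r) bs f) = foldr (avg r) bs (avg s c f)"
proof (induction bs)
  case (Cons b bs)
  have "avg s c (avg r b (foldr (avg r) bs f)) = avg r b (avg s c (foldr (avg r) bs f))"
    using avg_commute[OF holder_near_1_foldr[OF assms(1-3)] assms(2,4,3)] .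
  then show ?case by (simp add: Cons)
qed simp

lemma foldr_avg_increment_le:
  assumes "holder_near_1 \<delta> \<alpha> f" "0 < \<alpha>" "0 < r" "\<And>x. \<bar>f (x + v) - f x\<bar> \<le> K"
  shows "\<bar>foldr (avg r) bs f (x + v) - foldr (avg r) bs f x\<bar> \<le> K"
proof (induction bs arbitrary: x)
  case (Cons b bs)
  note h = holder_near_1_continuous[OF holder_near_1_foldr[OF assms(1-3)] assms(2)]
  show ?case
    using avg_increment_le[OF h assms(3) Cons] by simp
qed (use assms in simp)

text \<open>A layer in direction \<open>c\<close> does the smoothing: the layers inside it keep the
  increment bound \<open>K\<close>, and those outside it keep the Lipschitz bound it
  produces.\<close>

lemma foldr_avg_direction_le:
  assumes f: "holder_near_1 \<delta> \<alpha> f" and \<alpha>: "0 < \<alpha>" and r: "0 < r" and "c \<in> set bs"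
    and K: "\<And>x. \<bar>f (x + (2 * r) *\<^sub>R c) - f x\<bar> \<le> K"
  shows "\<bar>foldr (avg r) bs f (x + h *\<^sub>R c) - foldr (avg r) bs f x\<bar> \<le> K / (2 * r) * \<bar>h\<bar>"
  using assms(4)
proof (induction bs arbitrary: x)
  case (Cons b bs)
  note h = holder_near_1_continuous[OF holder_near_1_foldr[OF f \<alpha> r] \<alpha>]
  show ?case
  proof (cases "b = c")
    case True
    have "\<bar>avg r c (foldr (avg r) bs f) (x + h *\<^sub>R c) - avg r c (foldr (avg r) bs f) x\<bar> \<le> K / (2 * r) * \<bar>h\<bar>"
      using foldr_avg_increment_le[OF f \<alpha> r K] by (intro avg_direction_le h r)
    with True show ?thesis by simp
  next
    case False
    have "\<bar>avg r b (foldr (avg r) bs f) (x + h *\<^sub>R c) - avg r b (foldr (avg r) bs f) x\<bar> \<le> K / (2 * r) * \<bar>h\<bar>"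
      using Cons False by (intro avg_increment_le h r) auto
    then show ?thesis by simp
  qed
qed simp

text \<open>Averages in directions other than \<open>b\<close> suffice, because evenness along
  \<open>b\<close> is called for just before the average along \<open>b\<close> is taken.\<close>

lemma foldr_avg_reflection:
  assumes "holder_near_1 \<delta> \<alpha> f" "0 < \<alpha>" "0 < r" "b \<in> Basis" "set bs \<subseteq> Basis - {b}"
    and "\<And>x. f (x - (2 * (x \<bullet> b)) *\<^sub>R b) = f x"
  shows "foldr (avg r) bs f (x - (2 * (x \<bullet> b)) *\<^sub>R b) = foldr (avg r) bs f x"
  using assms(5)
proof (induction bs arbitrary: x)
  case (Cons c bs)
  note h = holder_near_1_continuous[OF holder_near_1_foldr[OF assms(1-3)] assms(2)]
  have "avg r c (foldr (avg r) bs f) (x - (2 * (x \<bullet> b)) *\<^sub>R b) = avg r c (foldr (avg r) bs f) x"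
    using Cons by (intro avg_reflection h assms(3,4)) auto
  then show ?case by simp
qed (use assms in simp)

section \<open>Lipschitz bounds from bounds along coordinate directions\<close>

lemma increment_le_of_directions:
  fixes f :: "'a::euclidean_space \<Rightarrow> real"
  assumes "finite J" and "\<And>b h x. b \<in> J \<Longrightarrow> \<bar>f (x + h *\<^sub>R b) - f x\<bar> \<le> \<Lambda> * \<bar>h\<bar>"
  shows "\<bar>f (x + (\<Sum>b\<in>J. c b *\<^sub>R b)) - f x\<bar> \<le> \<Lambda> * (\<Sum>b\<in>J. \<bar>c b\<bar>)"
  using assms
proof (induction J arbitrary: x rule: finite_induct)
  case (insert a J)
  have "\<bar>f (x + c a *\<^sub>R a) - f x\<bar> \<le> \<Lambda> * \<bar>c a\<bar>"
    using insert.prems by auto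
  moreover have "\<bar>f (x + c a *\<^sub>R a + (\<Sum>b\<in>J. c b *\<^sub>R b)) - f (x + c a *\<^sub>R a)\<bar> \<le> \<Lambda> * (\<Sum>b\<in>J. \<bar>c b\<bar>)"
    using insert by auto
  ultimately show ?case
    using insert.hyps by (simp add: algebra_simps)
qed simp

text \<open>\<open>J\<close> is \<open>Basis\<close> for general increments and
  \<open>Basis - {b}\<close> for those transverse to \<open>b\<close>. The dimension enters by
  bounding every coordinate of \<open>v\<close> by \<open>norm v\<close>.\<close>

lemma increment_le_norm:
  fixes f :: "'a::euclidean_space \<Rightarrow> real" and \<Lambda> :: real
  assumes J: "J \<subseteq> Basis" and f: "\<And>b h x. b \<in> J \<Longrightarrow> \<bar>f (x + h *\<^sub>R b) - f x\<bar> \<le> \<Lambda> * \<bar>h\<bar>"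
    and v: "\<And>b. b \<in> Basis - J \<Longrightarrow> v \<bullet> b = 0" and \<Lambda>: "0 \<le> \<Lambda>"
  shows "\<bar>f (x + v) - f x\<bar> \<le> DIM('a) * \<Lambda> * norm v"
proof -
  have fin: "finite J"
    using finite_subset[OF J finite_Basis] .
  have "v = (\<Sum>b\<in>Basis. (v \<bullet> b) *\<^sub>R b)"
    by (simp add: euclidean_representation)
  also have "\<dots> = (\<Sum>b\<in>J. (v \<bullet> b) *\<^sub>R b)"
    by (rule sum.mono_neutral_right) (use J v in auto)
  finally have 1: "\<bar>f (x + v) - f x\<bar> \<le> \<Lambda> * (\<Sum>b\<in>J. \<bar>v \<bullet> b\<bar>)"
    using increment_le_of_directions[OF fin f, where x=x and c="\<lambda>b. v \<bullet> b"] by metis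
  have "(\<Sum>b\<in>J. \<bar>v \<bullet> b\<bar>) \<le> (\<Sum>b\<in>Basis. \<bar>v \<bullet> b\<bar>)"
    by (rule sum_mono2) (use J in auto)
  also have "\<dots> \<le> DIM('a) * norm v"
    by (rule sum_bounded_above) (simp add: Basis_le_norm)
  finally have "(\<Sum>b\<in>J. \<bar>v \<bullet> b\<bar>) \<le> DIM('a) * norm v" .
  with \<Lambda> have "\<Lambda> * (\<Sum>b\<in>J. \<bar>v \<bullet> b\<bar>) \<le> \<Lambda> * (DIM('a) * norm v)"
    by (rule mult_left_mono[rotated])
  with 1 show ?thesis
    by (simp add: mult_ac)
qed

text \<open>The signed mass of \<open>p\<close> on the segment parallel to \<open>b\<close> from the
  hyperplane \<open>x \<bullet> b = 0\<close> to \<open>x\<close>.\<close>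

definition lineint :: "'a::euclidean_space \<Rightarrow> ('a \<Rightarrow> real) \<Rightarrow> 'a \<Rightarrow> real" where
  "lineint b p x = prim (\<lambda>t. p (x + (t - x \<bullet> b) *\<^sub>R b)) (x \<bullet> b)"

lemma DERIV_lineint:
  assumes p: "continuous_on UNIV p" and b: "b \<in> Basis"
  shows "((\<lambda>t. lineint b p (x + t *\<^sub>R b)) has_real_derivative p (x + t *\<^sub>R b)) (at t)"
proof -
  have eq: "lineint b p (x + t *\<^sub>R b) = prim (\<lambda>u. p (x + (u - x \<bullet> b) *\<^sub>R b)) (x \<bullet> b + t)" for t
    using b by (simp add: lineint_def inner_left_distrib algebra_simps)
  have "((\<lambda>t. prim (\<lambda>u. p (x + (u - x \<bullet> b) *\<^sub>R b)) (x \<bullet> b + t)) has_real_derivative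
      p (x + (x \<bullet> b + t - x \<bullet> b) *\<^sub>R b) * 1) (at t)"
    by (rule DERIV_prim_chain continuous_on_line p)+ (auto intro!: derivative_eq_intros)
  then show ?thesis
    by (simp add: eq)
qed

lemma lineint_0: "x \<bullet> b = 0 \<Longrightarrow> lineint b p x = 0"
  by (simp add: lineint_def)

lemma lineint_avg:
  assumes "continuous_on UNIV f"
  shows "lineint b (avg r b f) x = prim (avg1 r (\<lambda>t. f (x + (t - x \<bullet> b) *\<^sub>R b))) (x \<bullet> b)"
proof -
  have "avg r b f (x + (t - x \<bullet> b) *\<^sub>R b) = avg1 r (\<lambda>t. f (x + (t - x \<bullet> b) *\<^sub>R b)) t" for t
  proof -
    have "avg r b f (x - (x \<bullet> b) *\<^sub>R b + t *\<^sub>R b) = avg1 r (\<lambda>t. f (x - (x \<bullet> b) *\<^sub>R b + t *\<^sub>R b)) t"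
      by (rule avg_along_line[OF assms])
    moreover have "x - (x \<bullet> b) *\<^sub>R b + u *\<^sub>R b = x + (u - x \<bullet> b) *\<^sub>R b" for u
      by (simp add: scaleR_diff_left)
    ultimately show ?thesis by simp
  qed
  then show ?thesis
    unfolding lineint_def by (intro arg_cong2[where f=prim] ext) auto
qed

lemma line_reflection:
  assumes "b \<in> Basis" "\<And>x. f (x - (2 * (x \<bullet> b)) *\<^sub>R b) = f x"
  shows "f (x + (- t - x \<bullet> b) *\<^sub>R b) = f (x + (t - x \<bullet> b) *\<^sub>R b)"
proof -
  let ?y = "x + (t - x \<bullet> b) *\<^sub>R b"
  have "?y \<bullet> b = t"
    using assms(1) by (simp add: inner_left_distrib)
  then have "?y - (2 * (?y \<bullet> b)) *\<^sub>R b = x + (- t - x \<bullet> b) *\<^sub>R b"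
    by (simp add: scaleR_diff_left scaleR_2 flip: scaleR_scaleR)
  then show ?thesis
    using assms(2)[of ?y] by metis
qed

text \<open>Averaging reproduces the constant 1, so the one-dimensional estimate may be applied to
  \<open>\<phi> - 1\<close>. This makes the error proportional to \<delta>.\<close>

lemma lineint_avg_close:
  assumes f: "continuous_on UNIV f" and b: "b \<in> Basis" and r: "r > 0"
    and even: "\<And>x. f (x - (2 * (x \<bullet> b)) *\<^sub>R b) = f x" and \<delta>: "\<And>x. \<bar>f x - 1\<bar> \<le> \<delta>"
  shows "\<bar>lineint b (avg r b f) x - lineint b f x\<bar> \<le> \<delta> * r"
proof -
  define \<phi> where "\<phi> t = f (x + (t - x \<bullet> b) *\<^sub>R b)" for t
  have \<phi>: "continuous_on UNIV \<phi>"
    unfolding \<phi>_def by (rule continuous_on_line f)+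
  have one: "continuous_on UNIV (\<lambda>t::real. 1::real)"
    by simp
  have "\<bar>prim (avg1 r (\<lambda>t. \<phi> t - 1)) (x \<bullet> b) - prim (\<lambda>t. \<phi> t - 1) (x \<bullet> b)\<bar> \<le> \<delta> * r"
  proof (rule avg1_close_prim)
    show "continuous_on UNIV (\<lambda>t. \<phi> t - 1)"
      by (intro continuous_intros \<phi>)
    show "\<phi> (- t) - 1 = \<phi> t - 1" for t
      unfolding \<phi>_def using line_reflection[where f=f, OF b even] by simp
    show "\<bar>\<phi> t - 1\<bar> \<le> \<delta>" for t
      unfolding \<phi>_def by (rule \<delta>)
  qed (rule r)
  moreover have "avg1 r (\<lambda>t. \<phi> t - 1) = (\<lambda>t. avg1 r \<phi> t - 1)"
    using avg1_diff[OF \<phi> one] avg1_const[OF r] by auto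
  moreover have "prim (\<lambda>t. avg1 r \<phi> t - 1) u = prim (avg1 r \<phi>) u - u" for u
    using prim_diff[OF continuous_avg1[OF \<phi> r] one, of u] prim_const[of 1 u] by simp
  moreover have "prim (\<lambda>t. \<phi> t - 1) u = prim \<phi> u - u" for u
    using prim_diff[OF \<phi> one, of u] prim_const[of 1 u] by simp
  ultimately show ?thesis
    by (simp add: lineint_avg[OF f] lineint_def[of b f] flip: \<phi>_def)
qed

text \<open>The averaging error of a line integral is linear in \<open>f\<close>, so the
  one-dimensional estimate applies to the difference of \<open>f\<close> on the two parallel lines
  through \<open>x\<close> and \<open>x + v\<close>.\<close>

lemma lineint_avg_transverse:
  assumes f: "continuous_on UNIV f" and b: "b \<in> Basis" and r: "r > 0"
    and even: "\<And>x. f (x - (2 * (x \<bullet> b)) *\<^sub>R b) = f x" and v: "v \<bullet> b = 0"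
    and K: "\<And>x. \<bar>f (x + v) - f x\<bar> \<le> K"
  shows "\<bar>(lineint b (avg r b f) (x + v) - lineint b f (x + v))
         - (lineint b (avg r b f) x - lineint b f x)\<bar> \<le> K * r"
proof -
  define \<phi> where "\<phi> t = f (x + (t - x \<bullet> b) *\<^sub>R b)" for t
  define \<psi> where "\<psi> t = f (x + v + (t - (x + v) \<bullet> b) *\<^sub>R b)" for t
  have \<phi>: "continuous_on UNIV \<phi>"
    unfolding \<phi>_def by (rule continuous_on_line f)+
  have \<psi>: "continuous_on UNIV \<psi>"
    unfolding \<psi>_def by (rule continuous_on_line f)+
  have "\<bar>prim (avg1 r (\<lambda>t. \<psi> t - \<phi> t)) (x \<bullet> b) - prim (\<lambda>t. \<psi> t - \<phi> t) (x \<bullet> b)\<bar> \<le> K * r"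
  proof (rule avg1_close_prim)
    show "continuous_on UNIV (\<lambda>t. \<psi> t - \<phi> t)"
      by (intro continuous_intros \<phi> \<psi>)
    show "\<psi> (- t) - \<phi> (- t) = \<psi> t - \<phi> t" for t
      unfolding \<phi>_def \<psi>_def using line_reflection[where f=f, OF b even] by simp
    show "\<bar>\<psi> t - \<phi> t\<bar> \<le> K" for t
    proof -
      have "\<psi> t = f (x + (t - x \<bullet> b) *\<^sub>R b + v)"
        using v by (simp add: \<psi>_def inner_left_distrib algebra_simps)
      then show ?thesis
        unfolding \<phi>_def using K by simp
    qed
  qed (rule r)
  moreover have "avg1 r (\<lambda>t. \<psi> t - \<phi> t) = (\<lambda>t. avg1 r \<psi> t - avg1 r \<phi> t)"
    using avg1_diff[OF \<psi> \<phi>] by auto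
  moreover have "lineint b (avg r b f) (x + v) = prim (avg1 r \<psi>) (x \<bullet> b)"
      "lineint b f (x + v) = prim \<psi> (x \<bullet> b)"
    using v by (simp_all add: lineint_avg[OF f] lineint_def[of b f] \<psi>_def[abs_def] inner_left_distrib)
  moreover have "lineint b (avg r b f) x = prim (avg1 r \<phi>) (x \<bullet> b)" "lineint b f x = prim \<phi> (x \<bullet> b)"
    by (simp_all add: lineint_avg[OF f] lineint_def[of b f] \<phi>_def[abs_def])
  ultimately show ?thesis
    by (simp add: prim_diff[OF \<psi> \<phi>] prim_diff[OF continuous_avg1[OF \<psi> r] continuous_avg1[OF \<phi> r]])
qed

lemma lineint_avg_1:
  assumes f: "continuous_on UNIV f" and b: "b \<in> Basis" and r: "r > 0"
    and even: "\<And>x. f (x - (2 * (x \<bullet> b)) *\<^sub>R b) = f x" and per: "\<And>x. f (x + 2 *\<^sub>R b) = f x"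
    and x: "x \<bullet> b = 1"
  shows "lineint b (avg r b f) x = lineint b f x"
proof -
  have "prim (avg1 r (\<lambda>t. f (x + (t - x \<bullet> b) *\<^sub>R b))) 1 = prim (\<lambda>t. f (x + (t - x \<bullet> b) *\<^sub>R b)) 1"
  proof (rule prim_avg1_1)
    show "continuous_on UNIV (\<lambda>t. f (x + (t - x \<bullet> b) *\<^sub>R b))"
      by (rule continuous_on_line f)+
    show "f (x + (t + 2 - x \<bullet> b) *\<^sub>R b) = f (x + (t - x \<bullet> b) *\<^sub>R b)" for t
    proof -
      have "x + (t + 2 - x \<bullet> b) *\<^sub>R b = x + (t - x \<bullet> b) *\<^sub>R b + 2 *\<^sub>R b"
        by (simp add: algebra_simps)
      then show ?thesis by (simp only: per)
    qed
  qed (use r line_reflection[where f=f, OF b even] in auto)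
  then show ?thesis
    by (simp add: lineint_avg[OF f] lineint_def[of b f] x)
qed

lemma avg_near:
  assumes f: "holder_near_1 \<delta> \<alpha> f" and "0 < \<alpha>" "0 < r" "norm b = 1" "0 \<le> \<delta>"
  shows "\<bar>avg r b f x - f x\<bar> \<le> \<delta> * r powr \<alpha>"
proof -
  obtain t where t: "\<bar>t\<bar> < r" "avg r b f x = f (x + t *\<^sub>R b)"
    by (rule avg_mean_value[OF holder_near_1_continuous[OF f \<open>0 < \<alpha>\<close>] \<open>0 < r\<close>])
  have "\<bar>f (x + t *\<^sub>R b) - f x\<bar> \<le> \<delta> * norm (t *\<^sub>R b) powr \<alpha>"
    using f unfolding holder_near_1_def by blast
  also have "\<dots> \<le> \<delta> * r powr \<alpha>"
    using t assms by (intro mult_left_mono powr_mono2) auto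
  finally show ?thesis by (simp add: t)
qed

text \<open>The increment is split into a part \<open>v\<close> transverse to \<open>b\<close> and a
  part \<open>h\<close> along \<open>b\<close>. Transversally the factor \<open>r\<close>
  compensates the large constant \<open>\<Lambda>\<close>; along \<open>b\<close> the error has
  derivative \<open>avg r b f - f\<close>, which is at most \<delta> r^\<alpha>.\<close>

lemma lineint_avg_lipschitz:
  assumes f: "holder_near_1 \<delta> \<alpha> f" and "0 < \<alpha>" "0 \<le> \<delta>" and b: "b \<in> Basis" and r: "r > 0"
    and even: "\<And>x. f (x - (2 * (x \<bullet> b)) *\<^sub>R b) = f x"
    and \<Lambda>: "\<And>x v. v \<bullet> b = 0 \<Longrightarrow> \<bar>f (x + v) - f x\<bar> \<le> \<Lambda> * norm v" "0 \<le> \<Lambda>"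
  shows "\<bar>(lineint b (avg r b f) y - lineint b f y) - (lineint b (avg r b f) x - lineint b f x)\<bar>
     \<le> (\<Lambda> * r + \<delta> * r powr \<alpha>) * norm (y - x)"
proof -
  note c = holder_near_1_continuous[OF f \<open>0 < \<alpha>\<close>]
  note ca = holder_near_1_continuous[OF holder_near_1_avg[OF f \<open>0 < \<alpha>\<close> r] \<open>0 < \<alpha>\<close>]
  let ?E = "\<lambda>x. lineint b (avg r b f) x - lineint b f x"
  define h where "h = (y - x) \<bullet> b"
  define v where "v = y - x - h *\<^sub>R b"
  have vb: "v \<bullet> b = 0"
    using b by (simp add: v_def h_def inner_diff_left)
  have y: "y = x + v + h *\<^sub>R b"
    by (simp add: v_def)
  have h_le: "\<bar>h\<bar> \<le> norm (y - x)"
    using Basis_le_norm[OF b] by (simp add: h_def)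
  have "norm v \<le> norm (y - x)"
  proof -
    have "(norm (y - x))\<^sup>2 = (norm v)\<^sup>2 + h\<^sup>2"
      using b vb unfolding power2_norm_eq_inner
      by (simp add: y inner_left_distrib inner_right_distrib inner_commute power2_eq_square)
    then show ?thesis
      by (smt (verit) norm_ge_zero power2_le_imp_le zero_le_power2)
  qed
  have "\<bar>?E (x + v) - ?E x\<bar> \<le> (\<Lambda> * norm v) * r"
    using lineint_avg_transverse[OF c b r even vb \<Lambda>(1)[OF vb]] .
  also have "\<dots> \<le> \<Lambda> * r * norm (y - x)"
    using \<open>norm v \<le> norm (y - x)\<close> \<Lambda>(2) r by (simp add: mult_left_mono mult_ac)
  finally have 1: "\<bar>?E (x + v) - ?E x\<bar> \<le> \<Lambda> * r * norm (y - x)" .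
  have "\<bar>?E (x + v + h *\<^sub>R b) - ?E (x + v + 0 *\<^sub>R b)\<bar> \<le> \<delta> * r powr \<alpha> * \<bar>h - 0\<bar>"
  proof (rule DERIV_abs_diff_le)
    fix t
    show "((\<lambda>t. ?E (x + v + t *\<^sub>R b)) has_real_derivative
        avg r b f (x + v + t *\<^sub>R b) - f (x + v + t *\<^sub>R b)) (at t)"
      by (intro DERIV_diff DERIV_lineint c ca b)
    show "\<bar>avg r b f (x + v + t *\<^sub>R b) - f (x + v + t *\<^sub>R b)\<bar> \<le> \<delta> * r powr \<alpha>"
      using b assms by (intro avg_near) auto
  qed
  then have "\<bar>?E y - ?E (x + v)\<bar> \<le> \<delta> * r powr \<alpha> * \<bar>h\<bar>"
    by (simp flip: y)
  also have "\<dots> \<le> \<delta> * r powr \<alpha> * norm (y - x)"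
    using h_le assms by (intro mult_left_mono) auto
  finally show ?thesis
    using 1 by (simp add: distrib_right)
qed

section \<open>Monotone rearrangement along a direction\<close>

text \<open>On each line parallel to \<open>b\<close> this determines \<open>P\<close> as the
  primitive of \<open>p\<close> that starts on the hyperplane \<open>x \<bullet> b = 0\<close>. The
  lower bound 1/2 makes the inverse of \<open>P\<close> along a line Lipschitz with constant
  2.\<close>

locale line_antiderivative =
  fixes b :: "'a::euclidean_space" and p P :: "'a \<Rightarrow> real"
  assumes b: "b \<in> Basis"
    and p_ge: "p x \<ge> 1/2"
    and p_cont: "continuous_on UNIV p"
    and P_deriv: "((\<lambda>t. P (x + t *\<^sub>R b)) has_real_derivative p (x + t *\<^sub>R b)) (at t)"
    and P_0: "x \<bullet> b = 0 \<Longrightarrow> P x = 0"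
begin

lemma growth:
  assumes "t \<le> u"
  shows "(u - t) / 2 \<le> P (x + u *\<^sub>R b) - P (x + t *\<^sub>R b)"
proof (cases "t = u")
  case False
  with assms have "t < u" by simp
  then obtain z where "P (x + u *\<^sub>R b) - P (x + t *\<^sub>R b) = (u - t) * p (x + z *\<^sub>R b)"
    using MVT2[OF \<open>t < u\<close> P_deriv] by blast
  moreover have "(u - t) * (1/2) \<le> (u - t) * p (x + z *\<^sub>R b)"
    using assms p_ge by (intro mult_left_mono) auto
  ultimately show ?thesis by simp
qed simp

lemma abs_diff_ge: "\<bar>u - t\<bar> \<le> 2 * \<bar>P (x + u *\<^sub>R b) - P (x + t *\<^sub>R b)\<bar>"
  using growth[of t u x] growth[of u t x] by (cases "t \<le> u") (simp_all add: abs_if field_simps)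

lemma ex1_level: "\<exists>!d. P (x + d *\<^sub>R b) = c"
proof -
  \<comment> \<open>By \<open>growth\<close>, \<open>P\<close> changes by at least
    \<open>m / 2\<close> over a length \<open>m\<close>, so its values at \<open>- m\<close> and
    \<open>m\<close> enclose \<open>c\<close>.\<close>
  define m where "m = 2 * \<bar>c - P x\<bar>"
  have m: "m \<ge> 0" by (simp add: m_def)
  have "\<exists>d\<ge>-m. d \<le> m \<and> P (x + d *\<^sub>R b) = c"
  proof (rule IVT')
    show "P (x + (- m) *\<^sub>R b) \<le> c" "c \<le> P (x + m *\<^sub>R b)"
      using growth[of "-m" 0 x] growth[of 0 m x] m by (auto simp: m_def)
    show "continuous_on {-m..m} (\<lambda>d. P (x + d *\<^sub>R b))"
      using DERIV_isCont[OF P_deriv] by (simp add: continuous_at_imp_continuous_on)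
  qed (use m in auto)
  then obtain d where "P (x + d *\<^sub>R b) = c" by blast
  moreover have "d' = d" if "P (x + d' *\<^sub>R b) = c" for d'
    using abs_diff_ge[of d' d x] that calculation by simp
  ultimately show ?thesis by blast
qed

end

text \<open>\<open>PQ_1\<close> says that both densities have equal mass on the unit segment of
  every line, so the rearrangement fixes both of its ends.\<close>

locale line_transport =
  src: line_antiderivative b p P + tgt: line_antiderivative b q Q for b p P q Q +
  assumes PQ_1: "x \<bullet> b = 1 \<Longrightarrow> P x = Q x"
begin

text \<open>The displacement at which the mass of \<open>q\<close> up to the image equals the mass
  of \<open>p\<close> up to \<open>x\<close>; \<open>move\<close> is then the monotone rearrangement
  on all lines parallel to \<open>b\<close> simultaneously.\<close>

definition shift :: "'a \<Rightarrow> real" where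
  "shift x = (THE d. Q (x + d *\<^sub>R b) = P x)"

definition move :: "'a \<Rightarrow> 'a" where
  "move x = x + shift x *\<^sub>R b"

lemma Q_shift: "Q (x + shift x *\<^sub>R b) = P x"
  unfolding shift_def by (rule theI') (rule tgt.ex1_level)

lemma shift_eqI: "Q (x + d *\<^sub>R b) = P x \<Longrightarrow> shift x = d"
  using Q_shift tgt.ex1_level by blast

lemma Q_move: "Q (move x) = P x"
  by (simp add: move_def Q_shift)

lemma abs_shift_le: "\<bar>shift x\<bar> \<le> 2 * \<bar>P x - Q x\<bar>"
  using tgt.abs_diff_ge[of "shift x" 0 x] by (simp add: Q_shift)

lemma norm_b: "norm b = 1"
  using src.b by simp

lemma inner_move:
  assumes "c \<in> Basis"
  shows "move x \<bullet> c = (if c = b then x \<bullet> b + shift x else x \<bullet> c)"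
  using assms src.b by (auto simp: move_def inner_left_distrib inner_not_same_Basis)

lemma shift_face: "x \<bullet> b = 0 \<or> x \<bullet> b = 1 \<Longrightarrow> shift x = 0"
  using src.P_0[of x] tgt.P_0[of x] PQ_1[of x] by (intro shift_eqI) auto

lemma move_face:
  assumes "c \<in> Basis" "x \<bullet> c = 0 \<or> x \<bullet> c = 1"
  shows "move x \<bullet> c = x \<bullet> c"
  using assms shift_face[of x] by (auto simp: inner_move)

text \<open>\<open>P\<close> and \<open>Q\<close> both increase along the line, and \<open>Q\<close>
  at the image equals \<open>P\<close> at the point, so images cannot change order.\<close>

lemma shift_mono:
  assumes "s \<le> t"
  shows "s + shift (x + s *\<^sub>R b) \<le> t + shift (x + t *\<^sub>R b)"
proof (rule ccontr)
  let ?s = "s + shift (x + s *\<^sub>R b)" and ?t = "t + shift (x + t *\<^sub>R b)"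
  assume "\<not> ?s \<le> ?t"
  then have "Q (x + ?t *\<^sub>R b) < Q (x + ?s *\<^sub>R b)"
    using tgt.growth[of ?t ?s x] by simp
  moreover have "Q (x + ?s *\<^sub>R b) = P (x + s *\<^sub>R b)" "Q (x + ?t *\<^sub>R b) = P (x + t *\<^sub>R b)"
    using Q_shift by (simp_all add: scaleR_add_left flip: add.assoc)
  ultimately show False
    using src.growth[OF assms, of x] assms by simp
qed

text \<open>On each line \<open>move\<close> is monotone and fixes the points with
  \<open>b\<close>-coordinate 0 and 1, so no point crosses them. \<open>z\<close> is the foot of the
  line through \<open>x\<close>.\<close>

lemma move_side:
  assumes "c \<in> Basis"
  shows "0 \<le> x \<bullet> c \<Longrightarrow> 0 \<le> move x \<bullet> c" "x \<bullet> c \<le> 1 \<Longrightarrow> move x \<bullet> c \<le> 1"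
proof -
  define z where "z = x - (x \<bullet> b) *\<^sub>R b"
  have z: "z \<bullet> b = 0" "z + (x \<bullet> b) *\<^sub>R b = x"
    using src.b by (simp_all add: z_def inner_diff_left)
  have end0: "shift z = 0"
    using z by (intro shift_face) auto
  have end1: "shift (z + 1 *\<^sub>R b) = 0"
    using z src.b by (intro shift_face) (auto simp: inner_left_distrib)
  show "0 \<le> move x \<bullet> c" if "0 \<le> x \<bullet> c"
    using shift_mono[of 0 "x \<bullet> b" z] that assms by (auto simp: inner_move end0 z split: if_splits)
  show "move x \<bullet> c \<le> 1" if "x \<bullet> c \<le> 1"
    using shift_mono[of "x \<bullet> b" 1 z] that assms end1 by (auto simp: inner_move z split: if_splits)
qed

text \<open>Used at \<open>y\<close>, the displacement \<open>shift x\<close> misses the right level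
  of \<open>Q\<close> by the change of \<open>P - Q\<close> between the points minus the change of
  \<open>?H\<close> over the length of \<open>shift x\<close>. The latter is a mixed difference of
  \<open>Q\<close>, at most \<open>2 * \<gamma>\<close> times
  \<open>\<Lambda> * norm (y - x)\<close>. Since \<open>q\<close> is at least 1/2, correcting the
  miss costs a factor 2.\<close>

lemma shift_lipschitz:
  assumes \<gamma>: "\<And>x. \<bar>P x - Q x\<bar> \<le> \<gamma>"
    and g: "\<And>x y. \<bar>(P y - Q y) - (P x - Q x)\<bar> \<le> g * norm (y - x)"
    and \<Lambda>: "\<And>x v. \<bar>q (x + v) - q x\<bar> \<le> \<Lambda> * norm v" "0 \<le> \<Lambda>"
  shows "\<bar>shift y - shift x\<bar> \<le> 2 * (g + 2 * \<gamma> * \<Lambda>) * norm (y - x)"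
proof -
  let ?H = "\<lambda>t. Q (y + t *\<^sub>R b) - Q (x + t *\<^sub>R b)"
  have "\<bar>?H (shift x) - ?H 0\<bar> \<le> (\<Lambda> * norm (y - x)) * \<bar>shift x - 0\<bar>"
  proof (rule DERIV_abs_diff_le)
    fix t
    show "(?H has_real_derivative q (y + t *\<^sub>R b) - q (x + t *\<^sub>R b)) (at t)"
      by (intro DERIV_diff tgt.P_deriv)
    show "\<bar>q (y + t *\<^sub>R b) - q (x + t *\<^sub>R b)\<bar> \<le> \<Lambda> * norm (y - x)"
      using \<Lambda>(1)[of "x + t *\<^sub>R b" "y - x"] by (simp add: algebra_simps)
  qed
  also have "\<dots> \<le> (\<Lambda> * norm (y - x)) * (2 * \<gamma>)"
    using abs_shift_le[of x] \<gamma>[of x] \<Lambda>(2) by (intro mult_left_mono) auto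
  finally have H: "\<bar>?H (shift x) - ?H 0\<bar> \<le> 2 * \<gamma> * \<Lambda> * norm (y - x)"
    by (simp add: mult_ac)
  have "Q (y + shift y *\<^sub>R b) - Q (y + shift x *\<^sub>R b)
      = ((P y - Q y) - (P x - Q x)) - (?H (shift x) - ?H 0)"
    by (simp add: Q_shift)
  then have "\<bar>Q (y + shift y *\<^sub>R b) - Q (y + shift x *\<^sub>R b)\<bar>
      \<le> g * norm (y - x) + 2 * \<gamma> * \<Lambda> * norm (y - x)"
    using H g[of y x] by linarith
  with tgt.abs_diff_ge[of "shift y" "shift x" y] show ?thesis
    by (simp add: algebra_simps)
qed

lemma move_dist:
  assumes "\<And>x y. \<bar>shift y - shift x\<bar> \<le> K * norm (y - x)"
  shows "dist (move x) (move y) \<le> (1 + K) * dist x y"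
proof -
  have "move y - move x = (y - x) + (shift y - shift x) *\<^sub>R b"
    by (simp add: move_def algebra_simps)
  then have "norm (move y - move x) \<le> norm (y - x) + \<bar>shift y - shift x\<bar> * norm b"
    by (metis norm_scaleR norm_triangle_ineq)
  with assms[of y x] show ?thesis
    by (simp add: norm_b dist_norm norm_minus_commute algebra_simps)
qed

lemma dist_move_self: "dist (move x) x \<le> 2 * \<bar>P x - Q x\<bar>"
  using abs_shift_le[of x] by (simp add: move_def dist_norm norm_b)

text \<open>The identity \<open>Q (move x) = P x\<close> is differentiated along a line. In
  Caratheodory's form the increment of \<open>Q\<close> is \<open>h (g s) * (g s - g t)\<close>;
  continuity of \<open>g\<close> keeps \<open>h (g s)\<close> positive near \<open>t\<close>, so one
  may divide by it.\<close>

lemma DERIV_shift: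
  assumes cont: "continuous_on UNIV shift"
  shows "((\<lambda>t. t + shift (x + t *\<^sub>R b)) has_real_derivative
      p (x + t *\<^sub>R b) / q (move (x + t *\<^sub>R b))) (at t)"
proof -
  define g where "g t = t + shift (x + t *\<^sub>R b)" for t
  have line: "x + g t *\<^sub>R b = move (x + t *\<^sub>R b)" for t
    by (simp add: g_def move_def algebra_simps)
  have g_cont: "isCont g t"
  proof -
    have "continuous_on UNIV g"
      unfolding g_def by (intro continuous_intros continuous_on_line cont)
    then show ?thesis
      by (simp add: continuous_on_eq_continuous_at)
  qed
  obtain h where h: "\<And>z. Q (x + z *\<^sub>R b) - Q (x + g t *\<^sub>R b) = h z * (z - g t)"
      "isCont h (g t)" "h (g t) = q (x + g t *\<^sub>R b)"
    using tgt.P_deriv[of x "g t"] unfolding CARAT_DERIV by blast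
  have hg: "((\<lambda>s. h (g s)) \<longlongrightarrow> q (x + g t *\<^sub>R b)) (at t)"
    using isCont_o2[OF g_cont, of h] h(2,3) by (simp add: isCont_def)
  have q0: "q (x + g t *\<^sub>R b) > 0"
    using tgt.p_ge[of "x + g t *\<^sub>R b"] by simp
  then have "\<forall>\<^sub>F s in at t. h (g s) > 0"
    using hg by (rule order_tendstoD(1)[rotated])
  moreover have "((\<lambda>s. (P (x + s *\<^sub>R b) - P (x + t *\<^sub>R b)) / (s - t) / h (g s))
      \<longlongrightarrow> p (x + t *\<^sub>R b) / q (x + g t *\<^sub>R b)) (at t)"
    using src.P_deriv[of x t] q0
    by (intro tendsto_divide hg) (auto simp: has_field_derivative_iff)
  moreover have "(g s - g t) / (s - t) = (P (x + s *\<^sub>R b) - P (x + t *\<^sub>R b)) / (s - t) / h (g s)"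
    if "h (g s) > 0" for s
    using h(1)[of "g s"] that by (simp add: line Q_move)
  ultimately have "((\<lambda>s. (g s - g t) / (s - t)) \<longlongrightarrow> p (x + t *\<^sub>R b) / q (x + g t *\<^sub>R b)) (at t)"
    by (elim Lim_transform_eventually eventually_mono) simp_all
  then show ?thesis
    by (simp add: has_field_derivative_iff line flip: g_def)
qed

end

section \<open>Push-forward under the rearrangement\<close>

lemma nn_integral_lborel_translate:
  fixes f :: "'a::euclidean_space \<Rightarrow> ennreal"
  assumes [measurable]: "f \<in> borel_measurable borel"
  shows "(\<integral>\<^sup>+x. f (x + c) \<partial>lborel) = (\<integral>\<^sup>+x. f x \<partial>lborel)"
proof -
  have "(\<integral>\<^sup>+x. f x \<partial>lborel) = (\<integral>\<^sup>+x. f x \<partial>distr lborel borel ((+) c))"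
    by (simp add: lborel_distr_plus)
  also have "\<dots> = (\<integral>\<^sup>+x. f (c + x) \<partial>lborel)"
    by (rule nn_integral_distr) auto
  finally show ?thesis by (simp add: add.commute)
qed

text \<open>The weight confines the starting point of each line to a slab of unit width; this
  replaces a Fubini decomposition of the space into a line and its orthogonal complement.\<close>

lemma nn_integral_by_lines:
  fixes f :: "'a::euclidean_space \<Rightarrow> ennreal"
  assumes [measurable]: "f \<in> borel_measurable borel" and b: "b \<in> Basis"
  shows "(\<integral>\<^sup>+x. f x \<partial>lborel) =
    (\<integral>\<^sup>+x. indicator {0..1} (x \<bullet> b) * (\<integral>\<^sup>+t. f (x + t *\<^sub>R b) \<partial>lborel) \<partial>lborel)"
proof -
  let ?I = "indicator {0..1} :: real \<Rightarrow> ennreal"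
  have one: "(\<integral>\<^sup>+t. ?I (s - t) \<partial>lborel) = 1" for s
  proof -
    have "(\<integral>\<^sup>+t. ?I (s - t) \<partial>lborel) = (\<integral>\<^sup>+t. indicator {s - 1..s} t \<partial>lborel)"
      by (intro nn_integral_cong) (auto simp: indicator_def)
    then show ?thesis by simp
  qed
  \<comment> \<open>The inserted factor has integral 1 in \<open>t\<close>. After the integrals are
    exchanged, translating \<open>x\<close> by \<open>t *\<^sub>R b\<close> moves \<open>t\<close>
    from the weight into \<open>f\<close>.\<close>
  have "(\<integral>\<^sup>+x. f x \<partial>lborel) = (\<integral>\<^sup>+x. (\<integral>\<^sup>+t. f x * ?I (x \<bullet> b - t) \<partial>lborel) \<partial>lborel)"
    by (intro nn_integral_cong) (simp add: nn_integral_cmult one)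
  also have "\<dots> = (\<integral>\<^sup>+t. (\<integral>\<^sup>+x. f x * ?I (x \<bullet> b - t) \<partial>lborel) \<partial>lborel)"
    by (rule lborel_pair.Fubini') measurable
  also have "\<dots> = (\<integral>\<^sup>+t. (\<integral>\<^sup>+x. f (x + t *\<^sub>R b) * ?I (x \<bullet> b) \<partial>lborel) \<partial>lborel)"
  proof (rule nn_integral_cong)
    fix t
    show "(\<integral>\<^sup>+x. f x * ?I (x \<bullet> b - t) \<partial>lborel) = (\<integral>\<^sup>+x. f (x + t *\<^sub>R b) * ?I (x \<bullet> b) \<partial>lborel)"
      using b nn_integral_lborel_translate[of "\<lambda>x. f x * ?I (x \<bullet> b - t)" "t *\<^sub>R b"]
      by (simp add: inner_left_distrib)
  qed
  also have "\<dots> = (\<integral>\<^sup>+x. (\<integral>\<^sup>+t. f (x + t *\<^sub>R b) * ?I (x \<bullet> b) \<partial>lborel) \<partial>lborel)"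
    by (rule lborel_pair.Fubini') measurable
  also have "\<dots> = (\<integral>\<^sup>+x. ?I (x \<bullet> b) * (\<integral>\<^sup>+t. f (x + t *\<^sub>R b) \<partial>lborel) \<partial>lborel)"
  proof (rule nn_integral_cong)
    fix x
    have "(\<lambda>t. f (x + t *\<^sub>R b)) \<in> borel_measurable lborel"
      by measurable
    then show "(\<integral>\<^sup>+t. f (x + t *\<^sub>R b) * ?I (x \<bullet> b) \<partial>lborel) = ?I (x \<bullet> b) * (\<integral>\<^sup>+t. f (x + t *\<^sub>R b) \<partial>lborel)"
      by (simp add: nn_integral_multc mult.commute)
  qed
  finally show ?thesis .
qed

text \<open>A measure on the whole space, so that maps of the whole space can be composed and pushed
  forward without restricting measurable spaces. The boundary of the cube is a null set.\<close>

definition cube_measure :: "('a::euclidean_space \<Rightarrow> real) \<Rightarrow> 'a measure" where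
  "cube_measure p = density lborel (\<lambda>x. ennreal (p x) * indicator (cbox 0 One) x)"

lemma sets_cube_measure [measurable_cong, simp]: "sets (cube_measure p) = sets borel"
  and space_cube_measure [simp]: "space (cube_measure p) = UNIV"
  by (simp_all add: cube_measure_def)

lemma measurable_cube_measure [simp]: "f \<in> cube_measure p \<rightarrow>\<^sub>M N \<longleftrightarrow> f \<in> borel \<rightarrow>\<^sub>M N"
  by (simp cong: measurable_cong_sets)

lemma emeasure_cube_measure:
  assumes "continuous_on UNIV p" "A \<in> sets borel"
  shows "emeasure (cube_measure p) A = (\<integral>\<^sup>+x. ennreal (p x) * indicator (cbox 0 One) x * indicator A x \<partial>lborel)"
  unfolding cube_measure_def using borel_measurable_continuous_onI[OF assms(1)] assms(2)
  by (subst emeasure_density) auto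

lemma mem_cbox_One: "x \<in> cbox 0 One \<longleftrightarrow> (\<forall>c\<in>Basis. 0 \<le> x \<bullet> c \<and> x \<bullet> c \<le> 1)"
  by (auto simp: mem_box)

context line_transport
begin

text \<open>Either the line misses the cube, or it meets it exactly for parameters from
  \<open>- s\<close> to \<open>1 - s\<close>, whose ends \<open>g\<close> fixes. Then the
  substitution by \<open>g\<close> has Jacobian \<open>p / q\<close>, in which \<open>q\<close>
  cancels.\<close>

lemma distr_move_line:
  assumes shift: "continuous_on UNIV shift" and A [measurable]: "A \<in> sets borel"
  shows "(\<integral>\<^sup>+t. ennreal (p (x + t *\<^sub>R b)) * indicator (cbox 0 One) (x + t *\<^sub>R b)
            * indicator A (move (x + t *\<^sub>R b)) \<partial>lborel)
       = (\<integral>\<^sup>+t. ennreal (q (x + t *\<^sub>R b)) * indicator (cbox 0 One) (x + t *\<^sub>R b)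
            * indicator A (x + t *\<^sub>R b) \<partial>lborel)"
proof (cases "\<forall>c\<in>Basis - {b}. 0 \<le> x \<bullet> c \<and> x \<bullet> c \<le> 1")
  case False
  then obtain c where c: "c \<in> Basis" "c \<noteq> b" "\<not> (0 \<le> x \<bullet> c \<and> x \<bullet> c \<le> 1)"
    by auto
  then have "(x + t *\<^sub>R b) \<bullet> c = x \<bullet> c" for t
    using src.b by (simp add: inner_left_distrib inner_not_same_Basis)
  with c have "x + t *\<^sub>R b \<notin> cbox 0 One" for t
    unfolding mem_cbox_One by metis
  then show ?thesis by simp
next
  case True
  define s where "s = x \<bullet> b"
  have cube: "x + t *\<^sub>R b \<in> cbox 0 One \<longleftrightarrow> t \<in> {- s..1 - s}" for t
  proof -
    have "(x + t *\<^sub>R b) \<bullet> c = (if c = b then s + t else x \<bullet> c)" if "c \<in> Basis" for c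
      using src.b that by (auto simp: inner_left_distrib inner_not_same_Basis s_def)
    then show ?thesis
      unfolding mem_cbox_One using True src.b by auto
  qed
  define g where "g t = t + shift (x + t *\<^sub>R b)" for t
  have line: "x + g t *\<^sub>R b = move (x + t *\<^sub>R b)" for t
    by (simp add: g_def move_def algebra_simps)
  have g0: "g (- s) = - s" and g1: "g (1 - s) = 1 - s"
    unfolding g_def using src.b by (simp_all add: shift_face inner_left_distrib inner_diff_left s_def)
  have q0: "q y > 0" "p y > 0" for y
    using tgt.p_ge[of y] src.p_ge[of y] by simp_all
  have move: "continuous_on UNIV move"
    unfolding move_def[abs_def] by (intro continuous_intros shift)
  let ?f = "\<lambda>u. q (x + u *\<^sub>R b) * indicator A (x + u *\<^sub>R b)"
  let ?g' = "\<lambda>t. p (x + t *\<^sub>R b) / q (move (x + t *\<^sub>R b))"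
  have meas: "(\<lambda>u. x + u *\<^sub>R b) \<in> borel_measurable borel"
    by (intro borel_measurable_continuous_onI continuous_intros)
  have "(\<integral>\<^sup>+t. ennreal (q (x + t *\<^sub>R b)) * indicator (cbox 0 One) (x + t *\<^sub>R b)
            * indicator A (x + t *\<^sub>R b) \<partial>lborel) = (\<integral>\<^sup>+t. ?f t * indicator {g (- s)..g (1 - s)} t \<partial>lborel)"
    using q0 by (intro nn_integral_cong) (auto simp: g0 g1 cube indicator_def)
  also have "\<dots> = (\<integral>\<^sup>+t. ?f (g t) * ?g' t * indicator {- s..1 - s} t \<partial>lborel)"
  proof (rule nn_integral_substitution)
    have "?f \<in> borel_measurable borel"
      using borel_measurable_continuous_onI[OF continuous_on_line(1)[OF tgt.p_cont]]
        measurable_compose[OF meas borel_measurable_indicator[OF A]] by (intro borel_measurable_times) auto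
    then show "set_borel_measurable borel {g (- s)..g (1 - s)} ?f"
      unfolding set_borel_measurable_def by measurable
    show "(g has_real_derivative ?g' t) (at t)" if "t \<in> {- s..1 - s}" for t
      unfolding g_def by (rule DERIV_shift[OF shift])
    show "continuous_on {- s..1 - s} ?g'"
    proof (rule continuous_on_divide)
      show "continuous_on {- s..1 - s} (\<lambda>t. p (x + t *\<^sub>R b))"
        by (rule continuous_on_line[OF src.p_cont])
      show "continuous_on {- s..1 - s} (\<lambda>t. q (move (x + t *\<^sub>R b)))"
        by (rule continuous_on_compose2[OF tgt.p_cont continuous_on_compose2[OF move]])
          (auto intro!: continuous_intros)
      show "\<forall>t\<in>{- s..1 - s}. q (move (x + t *\<^sub>R b)) \<noteq> 0"
        using q0 by (metis less_irrefl)
    qed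
    show "0 \<le> ?g' t" if "t \<in> {- s..1 - s}" for t
      using q0 by (simp add: less_imp_le)
  qed simp
  also have "\<dots> = (\<integral>\<^sup>+t. ennreal (p (x + t *\<^sub>R b)) * indicator (cbox 0 One) (x + t *\<^sub>R b)
            * indicator A (move (x + t *\<^sub>R b)) \<partial>lborel)"
  proof (intro nn_integral_cong)
    fix t
    have "?f (g t) * ?g' t = p (x + t *\<^sub>R b) * indicator A (move (x + t *\<^sub>R b))"
      using q0(1)[of "move (x + t *\<^sub>R b)"] by (simp add: line)
    then show "ennreal (?f (g t) * ?g' t * indicator {- s..1 - s} t) = ennreal (p (x + t *\<^sub>R b))
        * indicator (cbox 0 One) (x + t *\<^sub>R b) * indicator A (move (x + t *\<^sub>R b))"
      using q0 by (auto simp: cube indicator_def)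
  qed
  finally show ?thesis ..
qed

lemma distr_move:
  assumes shift: "continuous_on UNIV shift"
  shows "distr (cube_measure p) borel move = cube_measure q"
proof (rule measure_eqI)
  have move [measurable]: "move \<in> borel_measurable borel"
    unfolding move_def[abs_def]
    by (intro borel_measurable_continuous_onI continuous_intros shift)
  have [measurable]: "p \<in> borel_measurable borel" "q \<in> borel_measurable borel"
    using src.p_cont tgt.p_cont by (auto intro: borel_measurable_continuous_onI)
  fix A
  assume "A \<in> sets (distr (cube_measure p) borel move)"
  then have A [measurable]: "A \<in> sets borel" by simp
  have "emeasure (distr (cube_measure p) borel move) A = emeasure (cube_measure p) (move -` A)"
    using move by (subst emeasure_distr) simp_all
  also have "\<dots> = (\<integral>\<^sup>+x. ennreal (p x) * indicator (cbox 0 One) x * indicator A (move x) \<partial>lborel)"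
    using measurable_sets[OF move A] by (subst emeasure_cube_measure[OF src.p_cont]) (simp_all add: indicator_vimage)
  also have "\<dots> = (\<integral>\<^sup>+x. ennreal (q x) * indicator (cbox 0 One) x * indicator A x \<partial>lborel)"
    by (subst (1 2) nn_integral_by_lines[OF _ src.b]) (simp_all add: distr_move_line[OF shift A])
  also have "\<dots> = emeasure (cube_measure q) A"
    by (rule emeasure_cube_measure[OF tgt.p_cont A, symmetric])
  finally show "emeasure (distr (cube_measure p) borel move) A = emeasure (cube_measure q) A" .
qed simp

end

section \<open>Transport between successive averages\<close>

text \<open>All conditions are non-strict inequalities or equalities, so they survive composition
  and pointwise limits. That the open cube is kept follows later from the inverse, in
  \<open>cube_map_box\<close>.\<close>

definition cube_map :: "real \<Rightarrow> ('a::euclidean_space \<Rightarrow> 'a) \<Rightarrow> bool" where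
  "cube_map L S \<longleftrightarrow> (\<forall>x y. dist (S x) (S y) \<le> L * dist x y) \<and>
     (\<forall>x. \<forall>c\<in>Basis. (x \<bullet> c = 0 \<or> x \<bullet> c = 1 \<longrightarrow> S x \<bullet> c = x \<bullet> c) \<and>
        (0 \<le> x \<bullet> c \<longrightarrow> 0 \<le> S x \<bullet> c) \<and> (x \<bullet> c \<le> 1 \<longrightarrow> S x \<bullet> c \<le> 1))"

text \<open>Under composition the Lipschitz bound \<open>L\<close>, common to map and inverse,
  multiplies, while the displacement bound \<open>\<eta>\<close> adds; the latter makes the infinite
  composition converge.\<close>

definition transports ::
  "real \<Rightarrow> real \<Rightarrow> ('a::euclidean_space \<Rightarrow> 'a) \<Rightarrow> ('a \<Rightarrow> 'a) \<Rightarrow> ('a \<Rightarrow> real) \<Rightarrow> ('a \<Rightarrow> real) \<Rightarrow> bool" where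
  "transports L \<eta> S S' p q \<longleftrightarrow> cube_map L S \<and> cube_map L S' \<and>
     (\<forall>x. S' (S x) = x) \<and> (\<forall>x. S (S' x) = x) \<and>
     (\<forall>x. dist (S x) x \<le> \<eta>) \<and> (\<forall>x. dist (S' x) x \<le> \<eta>) \<and>
     distr (cube_measure p) borel S = cube_measure q"

lemma cube_map_continuous:
  assumes "cube_map L S"
  shows "continuous_on A S"
proof -
  have "dist (S x) (S y) \<le> \<bar>L\<bar> * dist x y" for x y
    using assms mult_right_mono[of L "\<bar>L\<bar>" "dist x y"] unfolding cube_map_def
    by (meson abs_ge_self order_trans zero_le_dist)
  then have "\<bar>L\<bar>-lipschitz_on A S"
    by (intro lipschitz_onI) auto
  then show ?thesis
    by (rule lipschitz_on_continuous_on)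
qed

lemma cube_map_mono:
  assumes "cube_map L S" "L \<le> M"
  shows "cube_map M S"
  using assms mult_right_mono[of L M] unfolding cube_map_def by (meson order_trans zero_le_dist)

lemma transports_mono:
  assumes "transports L \<eta> S S' p q" "L \<le> M" "\<eta> \<le> \<theta>"
  shows "transports M \<theta> S S' p q"
  using assms cube_map_mono[of L _ M] order_trans[OF _ \<open>\<eta> \<le> \<theta>\<close>] unfolding transports_def by blast

lemma cube_map_comp:
  assumes S: "cube_map L S" and R: "cube_map M R" and "0 \<le> L"
  shows "cube_map (L * M) (S \<circ> R)"
proof -
  have "dist (S (R x)) (S (R y)) \<le> L * M * dist x y" for x y
  proof -
    have "dist (S (R x)) (S (R y)) \<le> L * dist (R x) (R y)"
      using S by (simp add: cube_map_def)
    also have "\<dots> \<le> L * (M * dist x y)"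
      using R \<open>0 \<le> L\<close> by (intro mult_left_mono) (auto simp: cube_map_def)
    finally show ?thesis by (simp add: mult.assoc)
  qed
  then show ?thesis
    using S R by (simp add: cube_map_def)
qed

lemma transports_comp:
  assumes S: "transports L \<eta> S S' q s" and R: "transports M \<theta> R R' p q" and "0 \<le> L" "0 \<le> M"
  shows "transports (L * M) (\<eta> + \<theta>) (S \<circ> R) (R' \<circ> S') p s"
  unfolding transports_def
proof (intro conjI allI)
  show "cube_map (L * M) (S \<circ> R)" "cube_map (L * M) (R' \<circ> S')"
    using cube_map_comp[of L S M R] cube_map_comp[of M R' L S'] assms
    by (auto simp: transports_def mult.commute)
  show "(R' \<circ> S') ((S \<circ> R) x) = x" "(S \<circ> R) ((R' \<circ> S') x) = x" for x
    using S R by (auto simp: transports_def)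
  show "dist ((S \<circ> R) x) x \<le> \<eta> + \<theta>" for x
    using S R dist_triangle[of "S (R x)" x "R x"] unfolding transports_def comp_def
    by (smt (verit))
  show "dist ((R' \<circ> S') x) x \<le> \<eta> + \<theta>" for x
    using S R dist_triangle[of "R' (S' x)" x "S' x"] unfolding transports_def comp_def
    by (smt (verit))
  have [measurable]: "S \<in> borel_measurable borel" "R \<in> borel_measurable borel"
    using S R cube_map_continuous by (auto simp: transports_def intro!: borel_measurable_continuous_onI)
  have "distr (cube_measure p) borel (S \<circ> R) = distr (distr (cube_measure p) borel R) borel S"
    by (subst distr_distr) auto
  then show "distr (cube_measure p) borel (S \<circ> R) = cube_measure s"
    using S R by (simp add: transports_def)
qed

lemma transports_id: "transports 1 0 id id p p"
  by (auto simp: transports_def cube_map_def distr_id2 id_def)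

section \<open>The rearrangement together with its inverse\<close>

lemma (in line_transport) swap: "line_transport b q Q p P"
  by unfold_locales (simp add: PQ_1)

text \<open>Exchanging the two densities inverts the rearrangement: \<open>x\<close> is the point of
  its line at which \<open>P\<close> takes the value \<open>Q (move x)\<close>.\<close>

lemma (in line_transport) move_inverse: "line_transport.move b Q P (move x) = x"
proof -
  interpret inv: line_transport b q Q p P by (rule swap)
  have "inv.shift (move x) = - shift x"
    by (rule inv.shift_eqI) (simp add: Q_move, simp add: move_def)
  then show ?thesis
    by (simp add: inv.move_def) (simp add: move_def)
qed

text \<open>The inverse is estimated by the same lemma with the densities exchanged, hence one
  constant \<open>\<Lambda>\<close> for both \<open>p\<close> and \<open>q\<close>.\<close>

lemma (in line_transport) transports_move:
  assumes \<gamma>: "\<And>x. \<bar>P x - Q x\<bar> \<le> \<gamma>"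
    and g: "\<And>x y. \<bar>(P y - Q y) - (P x - Q x)\<bar> \<le> g * norm (y - x)"
    and q: "\<And>x v. \<bar>q (x + v) - q x\<bar> \<le> \<Lambda> * norm v" and p: "\<And>x v. \<bar>p (x + v) - p x\<bar> \<le> \<Lambda> * norm v"
    and "0 \<le> \<Lambda>"
  shows "transports (1 + 2 * (g + 2 * \<gamma> * \<Lambda>)) (2 * \<gamma>) move (line_transport.move b Q P) p q"
proof -
  interpret inv: line_transport b q Q p P by (rule swap)
  have inv_g: "\<bar>(Q y - P y) - (Q x - P x)\<bar> \<le> g * norm (y - x)" for x y
    using g[of x y] by (simp add: norm_minus_commute)
  have inv_\<gamma>: "\<bar>Q x - P x\<bar> \<le> \<gamma>" for x
    using \<gamma>[of x] by simp
  note lip = shift_lipschitz[OF \<gamma> g q \<open>0 \<le> \<Lambda>\<close>]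
  note inv_lip = inv.shift_lipschitz[OF inv_\<gamma> inv_g p \<open>0 \<le> \<Lambda>\<close>]
  have "cube_map (1 + 2 * (g + 2 * \<gamma> * \<Lambda>)) move"
    using move_dist[OF lip] move_face move_side by (auto simp: cube_map_def)
  moreover have "cube_map (1 + 2 * (g + 2 * \<gamma> * \<Lambda>)) inv.move"
    using inv.move_dist[OF inv_lip] inv.move_face inv.move_side by (auto simp: cube_map_def)
  moreover have "distr (cube_measure p) borel move = cube_measure q"
  proof (rule distr_move)
    have "continuous_on UNIV move"
      using \<open>cube_map _ move\<close> by (rule cube_map_continuous)
    then have "continuous_on UNIV (\<lambda>x. (move x - x) \<bullet> b)"
      by (intro continuous_intros)
    then show "continuous_on UNIV shift"
      using src.b by (simp add: move_def)
  qed
  moreover have "dist (move x) x \<le> 2 * \<gamma>" for x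
    by (rule order_trans[OF dist_move_self]) (use \<gamma>[of x] in simp)
  moreover have "dist (inv.move x) x \<le> 2 * \<gamma>" for x
    by (rule order_trans[OF inv.dist_move_self]) (use inv_\<gamma>[of x] in simp)
  ultimately show ?thesis
    using move_inverse inv.move_inverse by (simp add: transports_def)
qed

text \<open>\<open>f\<close> stands for a density already averaged in all coordinates but
  \<open>b\<close>, which is the source of \<open>dir\<close>; along \<open>b\<close> it is merely
  Hoelder. The primitives \<open>P\<close> and \<open>Q\<close> are compared through the primitive
  \<open>F\<close> of \<open>f\<close> itself, so that the averaging estimates apply to each window
  separately.\<close>

lemma avg_step:
  fixes f :: "'a::euclidean_space \<Rightarrow> real" and \<delta> \<alpha> r :: real
  assumes f: "holder_near_1 \<delta> \<alpha> f" and \<alpha>: "0 < \<alpha>" "\<alpha> \<le> 1" and \<delta>: "0 \<le> \<delta>" "\<delta> \<le> 1/2"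
    and b: "b \<in> Basis" and r: "0 < r"
    and even: "\<And>x. f (x - (2 * (x \<bullet> b)) *\<^sub>R b) = f x" and per: "\<And>x. f (x + 2 *\<^sub>R b) = f x"
    and dir: "\<And>c h x. c \<in> Basis - {b} \<Longrightarrow> \<bar>f (x + h *\<^sub>R c) - f x\<bar> \<le> \<delta> * r powr (\<alpha> - 1) * \<bar>h\<bar>"
  shows "\<exists>S S'. transports (exp (12 * real DIM('a) * \<delta> * r powr \<alpha>)) (2 * r) S S' (avg (r / 2) b f) (avg r b f)"
proof -
  let ?N = "real DIM('a)"
  define p where "p = avg (r / 2) b f"
  define q where "q = avg r b f"
  define P where "P = lineint b p"
  define Q where "Q = lineint b q"
  define F where "F = lineint b f"
  define e where "e = \<delta> * r powr \<alpha>"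
  define \<Lambda> where "\<Lambda> = ?N * (\<delta> * r powr (\<alpha> - 1))"
  have r2: "0 < r / 2" using r by simp
  have e0: "0 \<le> e" using \<delta> by (simp add: e_def)
  have \<Lambda>0: "0 \<le> \<Lambda>" using \<delta> by (simp add: \<Lambda>_def)
  have \<Lambda>r: "\<Lambda> * r = ?N * e"
    using r by (simp add: \<Lambda>_def e_def powr_diff)
  have N1: "1 \<le> ?N"
    by (simp add: Suc_leI)
  note c = holder_near_1_continuous[OF f \<alpha>(1)]
  have hp: "holder_near_1 \<delta> \<alpha> p" and hq: "holder_near_1 \<delta> \<alpha> q"
    unfolding p_def q_def using f \<alpha>(1) r by (auto intro: holder_near_1_avg)
  note cp = holder_near_1_continuous[OF hp \<alpha>(1)]
  note cq = holder_near_1_continuous[OF hq \<alpha>(1)]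
  have ge: "1 / 2 \<le> p x" "1 / 2 \<le> q x" for x
  proof -
    have "\<bar>p x - 1\<bar> \<le> \<delta>" "\<bar>q x - 1\<bar> \<le> \<delta>"
      using hp hq by (auto simp: holder_near_1_def)
    with \<delta> show "1 / 2 \<le> p x" "1 / 2 \<le> q x" by - linarith+
  qed
  interpret line_transport b p P q Q
  proof unfold_locales
    show "P x = Q x" if "x \<bullet> b = 1" for x
      unfolding P_def Q_def p_def q_def
      using lineint_avg_1[where f=f, OF c b r even per that] lineint_avg_1[where f=f, OF c b r2 even per that] by simp
  qed (use b ge cp cq in \<open>auto simp: P_def Q_def lineint_0 intro: DERIV_lineint\<close>)
  \<comment> \<open>Serves both windows, \<open>s = r / 2\<close> and \<open>s = r\<close>. Along
    \<open>b\<close> the window length \<open>2 * s\<close> is at least \<open>r\<close>, and the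
    power is decreasing because its exponent \<alpha> - 1 is at most 0.\<close>
  have avg_lip: "\<bar>avg s b f (x + v) - avg s b f x\<bar> \<le> \<Lambda> * norm v" if s: "0 < s" "r \<le> 2 * s" for s x v
    unfolding \<Lambda>_def
  proof (rule increment_le_norm[OF order_refl])
    fix a h x
    assume a: "a \<in> (Basis :: 'a set)"
    show "\<bar>avg s b f (x + h *\<^sub>R a) - avg s b f x\<bar> \<le> \<delta> * r powr (\<alpha> - 1) * \<bar>h\<bar>"
    proof (cases "a = b")
      case True
      have "\<bar>f (x + (2 * s) *\<^sub>R b) - f x\<bar> \<le> \<delta> * (2 * s) powr \<alpha>" for x
      proof -
        have "\<bar>f (x + (2 * s) *\<^sub>R b) - f x\<bar> \<le> \<delta> * norm ((2 * s) *\<^sub>R b) powr \<alpha>"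
          using f unfolding holder_near_1_def by blast
        then show ?thesis using b s by simp
      qed
      then have "\<bar>avg s b f (x + h *\<^sub>R b) - avg s b f x\<bar> \<le> \<delta> * (2 * s) powr \<alpha> / (2 * s) * \<bar>h\<bar>"
        by (rule avg_direction_le[OF c s(1)])
      also have "\<delta> * (2 * s) powr \<alpha> / (2 * s) = \<delta> * (2 * s) powr (\<alpha> - 1)"
        using s by (simp add: powr_diff)
      also have "\<delta> * (2 * s) powr (\<alpha> - 1) * \<bar>h\<bar> \<le> \<delta> * r powr (\<alpha> - 1) * \<bar>h\<bar>"
        using s r \<alpha> \<delta> by (intro mult_right_mono mult_left_mono powr_mono2') auto
      finally show ?thesis by (simp add: True)
    next
      case False
      with a show ?thesis
        by (intro avg_increment_le[OF c s(1)] dir) auto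
    qed
  qed (use \<delta> in auto)
  have f_lip: "\<bar>f (x + v) - f x\<bar> \<le> \<Lambda> * norm v" if "v \<bullet> b = 0" for x v
    unfolding \<Lambda>_def
    by (rule increment_le_norm[where J="Basis - {b}"]) (use that \<delta> dir in auto)
  have "\<bar>P x - Q x\<bar> \<le> 2 * \<delta> * r" for x
  proof -
    have f1: "\<bar>f y - 1\<bar> \<le> \<delta>" for y
      using f by (simp add: holder_near_1_def)
    have "\<bar>P x - F x\<bar> \<le> \<delta> * (r / 2)"
      unfolding P_def F_def p_def by (rule lineint_avg_close[where f=f, OF c b r2 even f1])
    moreover have "\<bar>Q x - F x\<bar> \<le> \<delta> * r"
      unfolding Q_def F_def q_def by (rule lineint_avg_close[where f=f, OF c b r even f1])
    moreover have "0 \<le> \<delta> * r" using \<delta> r by simp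
    ultimately show ?thesis by linarith
  qed
  moreover have "\<bar>(P y - Q y) - (P x - Q x)\<bar> \<le> (4 * ?N * e) * norm (y - x)" for x y
  proof -
    have "\<bar>(P y - F y) - (P x - F x)\<bar> \<le> (\<Lambda> * (r / 2) + \<delta> * (r / 2) powr \<alpha>) * norm (y - x)"
      unfolding P_def p_def F_def by (rule lineint_avg_lipschitz[where f=f, OF f \<alpha>(1) \<delta>(1) b r2 even f_lip \<Lambda>0])
    also have "\<dots> \<le> (?N * e + e) * norm (y - x)"
    proof (intro mult_right_mono add_mono)
      show "\<Lambda> * (r / 2) \<le> ?N * e"
        using \<Lambda>r e0 N1 by simp
      show "\<delta> * (r / 2) powr \<alpha> \<le> e"
        unfolding e_def using \<delta> r \<alpha> by (intro mult_left_mono powr_mono2) auto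
    qed auto
    finally have 1: "\<bar>(P y - F y) - (P x - F x)\<bar> \<le> (?N * e + e) * norm (y - x)" .
    have 2: "\<bar>(Q y - F y) - (Q x - F x)\<bar> \<le> (?N * e + e) * norm (y - x)"
      using lineint_avg_lipschitz[where f=f, OF f \<alpha>(1) \<delta>(1) b r even f_lip \<Lambda>0, of y x]
      unfolding Q_def q_def F_def \<Lambda>r e_def .
    have "\<bar>(P y - Q y) - (P x - Q x)\<bar> \<le> 2 * ((?N * e + e) * norm (y - x))"
      using 1 2 by linarith
    also have "\<dots> \<le> 4 * ?N * e * norm (y - x)"
    proof -
      have "e \<le> ?N * e"
        using mult_right_mono[OF N1 e0] by (simp only: mult_1_left)
      then have "2 * (?N * e + e) \<le> 4 * ?N * e"
        by (simp add: algebra_simps)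
      then have "2 * (?N * e + e) * norm (y - x) \<le> 4 * ?N * e * norm (y - x)"
        by (rule mult_right_mono) simp
      then show ?thesis
        by (simp only: mult.assoc)
    qed
    finally show ?thesis .
  qed
  moreover have "\<bar>q (x + v) - q x\<bar> \<le> \<Lambda> * norm v" "\<bar>p (x + v) - p x\<bar> \<le> \<Lambda> * norm v" for x v
    unfolding p_def q_def using r by (auto intro: avg_lip)
  ultimately have T: "transports (1 + 2 * (4 * ?N * e + 2 * (2 * \<delta> * r) * \<Lambda>)) (2 * (2 * \<delta> * r))
      move (line_transport.move b Q P) p q"
    using \<Lambda>0 by (rule transports_move)
  \<comment> \<open>Origin of 12: by \<delta> \<le> 1/2 the mixed term is at most
    \<open>2 * (?N * e)\<close>; with \<open>4 * ?N * e\<close> this makes 6, and the outer factor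
    doubles it.\<close>
  have "1 + 2 * (4 * ?N * e + 2 * (2 * \<delta> * r) * \<Lambda>) \<le> 1 + 12 * ?N * e"
  proof -
    have "2 * (2 * \<delta> * r) * \<Lambda> = 4 * \<delta> * (?N * e)"
      by (simp flip: \<Lambda>r)
    also have "\<dots> \<le> 2 * (?N * e)"
      using \<delta> e0 by (intro mult_right_mono) auto
    finally show ?thesis by simp
  qed
  also have "\<dots> \<le> exp (12 * ?N * e)"
    by (rule exp_ge_add_one_self)
  finally have L: "1 + 2 * (4 * ?N * e + 2 * (2 * \<delta> * r) * \<Lambda>) \<le> exp (12 * ?N * \<delta> * r powr \<alpha>)"
    by (simp add: e_def mult.assoc)
  have "2 * (2 * \<delta> * r) \<le> 2 * r"
    using \<delta> r mult_right_mono[of \<delta> "1/2" r] by simp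
  with T L have "transports (exp (12 * ?N * \<delta> * r powr \<alpha>)) (2 * r) move (line_transport.move b Q P) p q"
    by (rule transports_mono)
  then show ?thesis
    unfolding p_def q_def by blast
qed

text \<open>\<open>xs\<close> lists the coordinates already at scale \<open>r\<close>,
  \<open>ys\<close> those still at \<open>r / 2\<close>. One step moves the head of
  \<open>ys\<close> to the end of \<open>xs\<close>; commutation of averages makes the average along
  that coordinate the outermost one, as \<open>avg_step\<close> requires.\<close>

lemma smoothing_transport_aux:
  fixes \<rho> :: "'a::euclidean_space \<Rightarrow> real" and \<delta> \<alpha> r :: real
  assumes \<rho>: "holder_near_1 \<delta> \<alpha> \<rho>" and \<alpha>: "0 < \<alpha>" "\<alpha> \<le> 1" and \<delta>: "0 \<le> \<delta>" "\<delta> \<le> 1/2" and r: "0 < r"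
    and even: "\<And>b x. b \<in> Basis \<Longrightarrow> \<rho> (x - (2 * (x \<bullet> b)) *\<^sub>R b) = \<rho> x"
    and per: "\<And>b x. b \<in> Basis \<Longrightarrow> \<rho> (x + 2 *\<^sub>R b) = \<rho> x"
    and "distinct (xs @ ys)" "set (xs @ ys) = Basis"
  shows "\<exists>S S'. transports (exp (length ys * (12 * real DIM('a) * \<delta> * r powr \<alpha>))) (length ys * (2 * r)) S S'
    (foldr (avg r) xs (foldr (avg (r / 2)) ys \<rho>)) (foldr (avg r) xs (foldr (avg r) ys \<rho>))"
  using assms(9,10)
proof (induction ys arbitrary: xs)
  case Nil
  show ?case
    using transports_id by fastforce
next
  case (Cons b ys)
  let ?K = "12 * real DIM('a) * \<delta> * r powr \<alpha>"
  have r2: "0 < r / 2" using r by simp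
  define g where "g = foldr (avg (r / 2)) ys \<rho>"
  define f where "f = foldr (avg r) xs g"
  have b: "b \<in> Basis" "set xs \<subseteq> Basis - {b}" "set ys \<subseteq> Basis - {b}"
    using Cons.prems by auto
  have hg: "holder_near_1 \<delta> \<alpha> g"
    unfolding g_def by (rule holder_near_1_foldr[OF \<rho> \<alpha>(1) r2])
  have hf: "holder_near_1 \<delta> \<alpha> f"
    unfolding f_def by (rule holder_near_1_foldr[OF hg \<alpha>(1) r])
  have "\<exists>S S'. transports (exp ?K) (2 * r) S S' (avg (r / 2) b f) (avg r b f)"
  proof (rule avg_step[OF hf \<alpha> \<delta> b(1) r])
    fix x
    have "g (x - (2 * (x \<bullet> b)) *\<^sub>R b) = g x" for x
      unfolding g_def by (rule foldr_avg_reflection[where f=\<rho>, OF \<rho> \<alpha>(1) r2 b(1,3) even[OF b(1)]])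
    then show "f (x - (2 * (x \<bullet> b)) *\<^sub>R b) = f x"
      unfolding f_def by (rule foldr_avg_reflection[where f=g, OF hg \<alpha>(1) r b(1,2)])
    have "\<bar>g (x + 2 *\<^sub>R b) - g x\<bar> \<le> 0" for x
      unfolding g_def using per[OF b(1)] by (intro foldr_avg_increment_le[where f=\<rho>, OF \<rho> \<alpha>(1) r2]) simp
    then have "\<bar>f (x + 2 *\<^sub>R b) - f x\<bar> \<le> 0"
      unfolding f_def by (rule foldr_avg_increment_le[where f=g, OF hg \<alpha>(1) r])
    then show "f (x + 2 *\<^sub>R b) = f x" by simp
  next
    fix c h x
    assume c: "c \<in> Basis - {b}"
    \<comment> \<open>Directions in \<open>xs\<close> have been averaged over length
      \<open>2 * r\<close>, those in \<open>ys\<close> only over length \<open>r\<close>. Both give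
      at most \<delta> r^(\<alpha> - 1), because \<alpha> \<le> 1.\<close>
    then consider "c \<in> set xs" | "c \<in> set ys"
      using Cons.prems by auto
    then show "\<bar>f (x + h *\<^sub>R c) - f x\<bar> \<le> \<delta> * r powr (\<alpha> - 1) * \<bar>h\<bar>"
    proof cases
      case 1
      have "\<bar>g (x + (2 * r) *\<^sub>R c) - g x\<bar> \<le> \<delta> * (2 * r) powr \<alpha>" for x
      proof -
        have "\<bar>g (x + (2 * r) *\<^sub>R c) - g x\<bar> \<le> \<delta> * norm ((2 * r) *\<^sub>R c) powr \<alpha>"
          using hg unfolding holder_near_1_def by blast
        then show ?thesis using c r by simp
      qed
      then have "\<bar>f (x + h *\<^sub>R c) - f x\<bar> \<le> \<delta> * (2 * r) powr \<alpha> / (2 * r) * \<bar>h\<bar>"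
        unfolding f_def by (rule foldr_avg_direction_le[where f=g, OF hg \<alpha>(1) r 1])
      also have "\<delta> * (2 * r) powr \<alpha> / (2 * r) = \<delta> * (2 * r) powr (\<alpha> - 1)"
        using r by (simp add: powr_diff)
      also have "\<delta> * (2 * r) powr (\<alpha> - 1) * \<bar>h\<bar> \<le> \<delta> * r powr (\<alpha> - 1) * \<bar>h\<bar>"
        using r \<alpha> \<delta> by (intro mult_right_mono mult_left_mono powr_mono2') auto
      finally show ?thesis .
    next
      case 2
      have "\<bar>\<rho> (x + (2 * (r / 2)) *\<^sub>R c) - \<rho> x\<bar> \<le> \<delta> * r powr \<alpha>" for x
      proof -
        have "\<bar>\<rho> (x + r *\<^sub>R c) - \<rho> x\<bar> \<le> \<delta> * norm (r *\<^sub>R c) powr \<alpha>"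
          using \<rho> unfolding holder_near_1_def by blast
        then show ?thesis using c r by simp
      qed
      then have "\<bar>g (x + h *\<^sub>R c) - g x\<bar> \<le> \<delta> * r powr \<alpha> / (2 * (r / 2)) * \<bar>h\<bar>" for x
        unfolding g_def by (rule foldr_avg_direction_le[where f=\<rho>, OF \<rho> \<alpha>(1) r2 2])
      also have "\<delta> * r powr \<alpha> / (2 * (r / 2)) = \<delta> * r powr (\<alpha> - 1)"
        using r by (simp add: powr_diff)
      finally show ?thesis
        unfolding f_def by (rule foldr_avg_increment_le[where f=g, OF hg \<alpha>(1) r])
    qed
  qed
  then obtain R R' where R: "transports (exp ?K) (2 * r) R R' (avg (r / 2) b f) (avg r b f)"
    by blast
  have "foldr (avg r) xs (foldr (avg (r / 2)) (b # ys) \<rho>) = avg (r / 2) b f"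
    unfolding f_def g_def[symmetric] foldr.simps comp_apply
    by (rule foldr_avg_commute[OF hg \<alpha>(1) r r2, symmetric])
  moreover have "foldr (avg r) (xs @ [b]) g = avg r b f"
    unfolding f_def foldr_append foldr.simps comp_apply id_apply
    by (rule foldr_avg_commute[OF hg \<alpha>(1) r r, symmetric])
  moreover obtain S S' where "transports (exp (length ys * ?K)) (length ys * (2 * r)) S S'
    (foldr (avg r) (xs @ [b]) (foldr (avg (r / 2)) ys \<rho>)) (foldr (avg r) (xs @ [b]) (foldr (avg r) ys \<rho>))"
    using Cons.IH[of "xs @ [b]"] Cons.prems by auto
  moreover have "foldr (avg r) (xs @ [b]) (foldr (avg r) ys \<rho>) = foldr (avg r) xs (foldr (avg r) (b # ys) \<rho>)"
    by simp
  ultimately have "transports (exp (length ys * ?K) * exp ?K) (length ys * (2 * r) + 2 * r) (S \<circ> R) (R' \<circ> S')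
    (foldr (avg r) xs (foldr (avg (r / 2)) (b # ys) \<rho>)) (foldr (avg r) xs (foldr (avg r) (b # ys) \<rho>))"
    using transports_comp[OF _ R] by (simp add: g_def)
  moreover have "exp (length ys * ?K) * exp ?K = exp (length (b # ys) * ?K)"
    by (simp add: distrib_right exp_add)
  moreover have "length ys * (2 * r) + 2 * r = length (b # ys) * (2 * r)"
    by (simp add: distrib_right)
  ultimately show ?case by metis
qed

lemma smoothing_transport:
  fixes \<rho> :: "'a::euclidean_space \<Rightarrow> real" and \<delta> \<alpha> r :: real
  assumes "holder_near_1 \<delta> \<alpha> \<rho>" "0 < \<alpha>" "\<alpha> \<le> 1" "0 \<le> \<delta>" "\<delta> \<le> 1/2" "0 < r"
    and "\<And>b x. b \<in> Basis \<Longrightarrow> \<rho> (x - (2 * (x \<bullet> b)) *\<^sub>R b) = \<rho> x"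
    and "\<And>b x. b \<in> Basis \<Longrightarrow> \<rho> (x + 2 *\<^sub>R b) = \<rho> x"
    and bs: "distinct bs" "set bs = Basis"
  shows "\<exists>S S'. transports (exp (12 * (real DIM('a))\<^sup>2 * \<delta> * r powr \<alpha>)) (2 * real DIM('a) * r) S S'
    (foldr (avg (r / 2)) bs \<rho>) (foldr (avg r) bs \<rho>)"
proof -
  have "length bs = DIM('a)"
    using bs distinct_card by metis
  then show ?thesis
    using smoothing_transport_aux[where \<rho>=\<rho> and xs="[]" and ys=bs, OF assms(1-8)] bs
    by (simp add: power2_eq_square mult_ac)
qed

lemma foldr_avg_near:
  assumes f: "holder_near_1 \<delta> \<alpha> f" and "0 < \<alpha>" "0 < r" "0 \<le> \<delta>" "set bs \<subseteq> Basis"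
  shows "\<bar>foldr (avg r) bs f x - f x\<bar> \<le> length bs * (\<delta> * r powr \<alpha>)"
  using assms(5)
proof (induction bs)
  case (Cons b bs)
  have "\<bar>avg r b (foldr (avg r) bs f) x - foldr (avg r) bs f x\<bar> \<le> \<delta> * r powr \<alpha>"
    by (rule avg_near[OF holder_near_1_foldr[OF f assms(2,3)] assms(2,3) _ assms(4)]) (use Cons.prems in auto)
  moreover have "\<bar>foldr (avg r) bs f x - f x\<bar> \<le> length bs * (\<delta> * r powr \<alpha>)"
    using Cons by simp
  ultimately have "\<bar>avg r b (foldr (avg r) bs f) x - f x\<bar> \<le> \<delta> * r powr \<alpha> + length bs * (\<delta> * r powr \<alpha>)"
    by linarith
  then show ?case by (simp add: distrib_right)
qed simp

text \<open>At half-side 1 the window is a full period, so the increment across it is 0 and with it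
  every directional Lipschitz constant.\<close>

lemma foldr_avg_1_const:
  fixes f :: "'a::euclidean_space \<Rightarrow> real"
  assumes f: "holder_near_1 \<delta> \<alpha> f" "0 < \<alpha>" and "set bs = Basis"
    and per: "\<And>b x. b \<in> Basis \<Longrightarrow> f (x + 2 *\<^sub>R b) = f x"
  shows "foldr (avg 1) bs f x = foldr (avg 1) bs f 0"
proof -
  have "\<bar>foldr (avg 1) bs f (0 + x) - foldr (avg 1) bs f 0\<bar> \<le> real DIM('a) * 0 * norm x"
  proof (rule increment_le_norm[where J=Basis])
    fix c :: 'a and h :: real and x :: 'a
    assume "c \<in> Basis"
    have "\<bar>foldr (avg 1) bs f (x + h *\<^sub>R c) - foldr (avg 1) bs f x\<bar> \<le> 0 / (2 * 1) * \<bar>h\<bar>"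
      by (rule foldr_avg_direction_le[where f=f, OF f]) (use \<open>c \<in> Basis\<close> assms in auto)
    then show "\<bar>foldr (avg 1) bs f (x + h *\<^sub>R c) - foldr (avg 1) bs f x\<bar> \<le> 0 * \<bar>h\<bar>"
      by simp
  qed auto
  then show ?thesis by simp
qed

section \<open>Limits of transport maps\<close>

text \<open>Pointwise convergence of maps controls only integrals of continuous functions. Closed
  sets generate the Borel sets, and the indicator of a closed set is the limit of cutoffs in the
  distance to it.\<close>

lemma measure_eqI_continuous:
  fixes M N :: "'a::metric_space measure"
  assumes M: "finite_measure M" "sets M = sets borel" and N: "finite_measure N" "sets N = sets borel"
    and eq: "\<And>\<phi> :: 'a \<Rightarrow> real. continuous_on UNIV \<phi> \<Longrightarrow> (\<And>x. 0 \<le> \<phi> x \<and> \<phi> x \<le> 1) \<Longrightarrow>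
      integral\<^sup>L M \<phi> = integral\<^sup>L N \<phi>"
  shows "M = N"
proof (rule measure_eqI_generator_eq[where E="Collect closed" and \<Omega>=UNIV and A="\<lambda>_. UNIV"])
  interpret M: finite_measure M by (rule M)
  interpret N: finite_measure N by (rule N)
  show "emeasure M C = emeasure N C" if "C \<in> Collect closed" for C
  \<comment> \<open>\<open>infdist\<close> to the empty set is 0, so the cutoffs would tend to 1
    instead of 0.\<close>
  proof (cases "C = {}")
    case False
    define \<phi> where "\<phi> n x = max 0 (1 - real n * infdist x C)" for n x
    have cont: "continuous_on UNIV (\<phi> n)" for n
      unfolding \<phi>_def by (intro continuous_intros)
    have bounds: "0 \<le> \<phi> n x \<and> \<phi> n x \<le> 1" for n x
      by (auto simp: \<phi>_def infdist_nonneg)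
    have C: "C \<in> sets borel" using that by auto
    have lim: "(\<lambda>n. \<phi> n x) \<longlonglongrightarrow> indicator C x" for x
    proof (cases "x \<in> C")
      case True
      then show ?thesis by (simp add: \<phi>_def)
    next
      case x: False
      then have pos: "infdist x C > 0"
        using in_closed_iff_infdist_zero[of C x] that False infdist_nonneg[of x C] by auto
      then obtain m where m: "1 < real m * infdist x C"
        using ex_less_of_nat_mult by blast
      have "\<phi> n x = 0" if "n \<ge> m" for n
        using m mult_right_mono[of "real m" "real n" "infdist x C"] that infdist_nonneg[of x C]
        by (simp add: \<phi>_def)
      then have "\<forall>\<^sub>F n in sequentially. \<phi> n x = 0"
        unfolding eventually_sequentially by blast
      with x show ?thesis
        by (simp add: tendsto_eventually)
    qed
    have "(\<lambda>n. integral\<^sup>L K (\<phi> n)) \<longlonglongrightarrow> measure K C"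
      if K: "finite_measure K" "sets K = sets borel" for K
    proof -
      interpret K: finite_measure K by (rule K)
      have [measurable]: "\<phi> n \<in> borel_measurable K" for n
        using cont borel_measurable_continuous_onI measurable_cong_sets[OF K(2) refl] by blast
      have [measurable]: "C \<in> sets K"
        using C K by simp
      have "(\<lambda>n. integral\<^sup>L K (\<phi> n)) \<longlonglongrightarrow> integral\<^sup>L K (indicator C)"
        by (rule integral_dominated_convergence[where w="\<lambda>_. 1"]) (use lim bounds in auto)
      then show ?thesis by simp
    qed
    from this[OF M] this[OF N] have "measure M C = measure N C"
      using eq[OF cont bounds] LIMSEQ_unique by auto
    then show ?thesis
      by (simp add: M.emeasure_eq_measure N.emeasure_eq_measure)
  qed simp
  show "sets M = sigma_sets UNIV (Collect closed)" "sets N = sigma_sets UNIV (Collect closed)"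
    using M(2) N(2) by (auto simp: borel_eq_closed)
qed (auto simp: Int_stable_def finite_measure.emeasure_finite[OF M(1), simplified] closed_Int)

lemma emeasure_cube: "emeasure lborel (cbox 0 (One :: 'a::euclidean_space)) = 1"
  by (subst emeasure_lborel_cbox) auto

lemma finite_cube_measure:
  fixes p :: "'a::euclidean_space \<Rightarrow> real"
  assumes "continuous_on UNIV p" "\<And>x. p x \<le> B"
  shows "finite_measure (cube_measure p)"
proof
  have "emeasure (cube_measure p) UNIV = (\<integral>\<^sup>+x. ennreal (p x) * indicator (cbox 0 One) x * indicator UNIV x \<partial>lborel)"
    by (rule emeasure_cube_measure[OF assms(1)]) simp
  also have "\<dots> \<le> (\<integral>\<^sup>+x. ennreal B * indicator (cbox 0 (One::'a)) x \<partial>lborel)"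
    using assms(2) by (intro nn_integral_mono) (auto simp: indicator_def ennreal_leI)
  also have "\<dots> = ennreal B"
    by (simp add: nn_integral_cmult emeasure_cube)
  finally show "emeasure (cube_measure p) (space (cube_measure p)) \<noteq> \<infinity>"
    by (auto simp: top_unique)
qed

lemma integral_cube_measure:
  fixes p :: "'a::euclidean_space \<Rightarrow> real" and g :: "'a \<Rightarrow> real"
  assumes "continuous_on UNIV p" "\<And>x. 0 \<le> p x" "g \<in> borel_measurable borel"
  shows "integral\<^sup>L (cube_measure p) g = (LINT x|lborel. p x * indicator (cbox 0 One) x * g x)"
proof -
  have "cube_measure p = density lborel (\<lambda>x. ennreal (p x * indicator (cbox 0 One) x))"
    unfolding cube_measure_def using assms(2)
    by (intro arg_cong[where f="density lborel"] ext) (auto simp: indicator_def)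
  also have "integral\<^sup>L \<dots> g = (LINT x|lborel. (p x * indicator (cbox 0 One) x) *\<^sub>R g x)"
    using assms borel_measurable_continuous_onI[OF assms(1)]
    by (intro integral_density) (auto intro!: borel_measurable_times borel_measurable_indicator)
  finally show ?thesis by simp
qed

text \<open>Densities and maps vary together, so both sides are tested with a continuous
  \<open>\<phi>\<close> between 0 and 1; the integrands converge pointwise and are dominated by
  \<open>B\<close> on the cube.\<close>

lemma cube_measure_limit:
  fixes p :: "nat \<Rightarrow> 'a::euclidean_space \<Rightarrow> real" and T :: "nat \<Rightarrow> 'a \<Rightarrow> 'a"
  assumes p: "\<And>k. continuous_on UNIV (p k)" "\<And>k x. 0 \<le> p k x" "\<And>k x. p k x \<le> B"
    and T: "\<And>k. continuous_on UNIV (T k)"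
    and q: "continuous_on UNIV q" "\<And>x. (\<lambda>k. p k x) \<longlonglongrightarrow> q x"
    and R: "continuous_on UNIV R" "\<And>x. (\<lambda>k. T k x) \<longlonglongrightarrow> R x"
    and M: "\<And>k. distr (cube_measure (p k)) borel (T k) = M"
  shows "distr (cube_measure q) borel R = M"
proof (rule measure_eqI_continuous)
  have q0: "0 \<le> q x" and qB: "q x \<le> B" for x
    using q(2)[of x] p(2,3) by (auto intro: LIMSEQ_le_const LIMSEQ_le_const2)
  have [measurable]: "p k \<in> borel_measurable borel" "T k \<in> borel_measurable borel"
    "q \<in> borel_measurable borel" "R \<in> borel_measurable borel" for k
    using p(1) T q(1) R(1) by (auto intro: borel_measurable_continuous_onI)
  show "finite_measure (distr (cube_measure q) borel R)"
    by (rule finite_measure.finite_measure_distr[OF finite_cube_measure[OF q(1) qB]]) simp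
  show "finite_measure M"
    unfolding M[of 0, symmetric]
    by (rule finite_measure.finite_measure_distr[OF finite_cube_measure[OF p(1,3)]]) simp
  show "sets M = sets borel"
    by (simp flip: M[of 0])
  fix \<phi> :: "'a \<Rightarrow> real"
  assume \<phi>: "continuous_on UNIV \<phi>" "\<And>x. 0 \<le> \<phi> x \<and> \<phi> x \<le> 1"
  have \<phi>_meas [measurable]: "\<phi> \<in> borel_measurable borel"
    by (rule borel_measurable_continuous_onI[OF \<phi>(1)])
  have *: "integral\<^sup>L (distr (cube_measure g) borel S) \<phi> = (LINT x|lborel. g x * indicator (cbox 0 One) x * \<phi> (S x))"
    if "continuous_on UNIV g" "\<And>x. 0 \<le> g x" "S \<in> borel_measurable borel" for g S
  proof -
    have "integral\<^sup>L (distr (cube_measure g) borel S) \<phi> = (LINT x|cube_measure g. \<phi> (S x))"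
      using that by (intro integral_distr) auto
    also have "\<dots> = (LINT x|lborel. g x * indicator (cbox 0 One) x * \<phi> (S x))"
      using that by (intro integral_cube_measure) auto
    finally show ?thesis .
  qed
  have "(\<lambda>k. LINT x|lborel. p k x * indicator (cbox 0 One) x * \<phi> (T k x))
      \<longlonglongrightarrow> (LINT x|lborel. q x * indicator (cbox 0 One) x * \<phi> (R x))"
  proof (rule integral_dominated_convergence[where w="\<lambda>x. B * indicator (cbox 0 One) x"])
    show "integrable lborel (\<lambda>x::'a. B * indicator (cbox 0 One) x)"
      by (intro integrable_mult_right integrable_real_indicator) (auto simp: emeasure_cube)
    have "isCont \<phi> y" for y
      using \<phi>(1) by (simp add: continuous_on_eq_continuous_at)
    then have "(\<lambda>k. \<phi> (T k x)) \<longlonglongrightarrow> \<phi> (R x)" for x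
      using R(2) by (rule isCont_tendsto_compose)
    then show "AE x in lborel. (\<lambda>k. p k x * indicator (cbox 0 One) x * \<phi> (T k x))
        \<longlonglongrightarrow> q x * indicator (cbox 0 One) x * \<phi> (R x)"
      by (intro always_eventually allI tendsto_mult tendsto_const q(2))
    show "AE x in lborel. norm (p k x * indicator (cbox 0 One) x * \<phi> (T k x)) \<le> B * indicator (cbox 0 One) x" for k
    proof (intro always_eventually allI)
      fix x
      have "p k x * \<phi> (T k x) \<le> B * 1"
        using p(2,3)[of k x] \<phi>(2)[of "T k x"] by (intro mult_mono) auto
      then show "norm (p k x * indicator (cbox 0 One) x * \<phi> (T k x)) \<le> B * indicator (cbox 0 One) x"
        using p(2)[of k x] \<phi>(2)[of "T k x"] by (auto simp: indicator_def abs_mult)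
    qed
  qed measurable
  moreover have "(LINT x|lborel. p k x * indicator (cbox 0 One) x * \<phi> (T k x)) = integral\<^sup>L M \<phi>" for k
    by (subst *[of "p k" "T k", symmetric]) (use p M in auto)
  ultimately have "(\<lambda>k. integral\<^sup>L M \<phi>) \<longlonglongrightarrow> integral\<^sup>L (distr (cube_measure q) borel R) \<phi>"
    by (subst *[of q R]) (use q(1) q0 in auto)
  then show "integral\<^sup>L (distr (cube_measure q) borel R) \<phi> = integral\<^sup>L M \<phi>"
    by (simp add: LIMSEQ_const_iff)
qed simp

lemma convergent_of_geometric_steps:
  fixes u :: "nat \<Rightarrow> 'a::banach"
  assumes "\<And>k. dist (u (Suc k)) (u k) \<le> C * (1 / 2) ^ k"
  shows "convergent u"
proof -
  have "summable (\<lambda>k. C * (1 / 2 :: real) ^ k)"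
    by (intro summable_mult summable_geometric) simp
  then have "summable (\<lambda>k. u (Suc k) - u k)"
    by (rule summable_comparison_test'[where N=0]) (use assms in \<open>simp add: dist_norm\<close>)
  then have "convergent (\<lambda>n. \<Sum>k<n. u (Suc k) - u k)"
    by (simp add: summable_iff_convergent)
  then have "convergent (\<lambda>n. u n - u 0)"
    by (simp add: sum_lessThan_telescope)
  then show ?thesis
    using convergent_add_const_right_iff[of u "- u 0"] by simp
qed

lemma cube_map_limit:
  assumes T: "\<And>k. cube_map L (T k)" and lim: "\<And>x. (\<lambda>k. T k x) \<longlonglongrightarrow> R x"
  shows "cube_map L R"
  unfolding cube_map_def
proof (intro conjI allI ballI impI)
  show "dist (R x) (R y) \<le> L * dist x y" for x y
    by (rule LIMSEQ_le_const2[OF tendsto_dist[OF lim lim]]) (use T in \<open>auto simp: cube_map_def\<close>)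
  fix x c :: 'a
  assume c: "c \<in> Basis"
  have *: "(\<lambda>k. T k x \<bullet> c) \<longlonglongrightarrow> R x \<bullet> c"
    by (intro tendsto_intros lim)
  show "0 \<le> R x \<bullet> c" if "0 \<le> x \<bullet> c"
    by (rule LIMSEQ_le_const[OF *]) (use T c that in \<open>auto simp: cube_map_def\<close>)
  show "R x \<bullet> c \<le> 1" if "x \<bullet> c \<le> 1"
    by (rule LIMSEQ_le_const2[OF *]) (use T c that in \<open>auto simp: cube_map_def\<close>)
  show "R x \<bullet> c = x \<bullet> c" if "x \<bullet> c = 0 \<or> x \<bullet> c = 1"
  proof -
    have "T k x \<bullet> c = x \<bullet> c" for k
      using T[of k] c that unfolding cube_map_def by blast
    with * show ?thesis
      by (simp add: LIMSEQ_const_iff)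
  qed
qed

text \<open>The Lipschitz bound is uniform in \<open>k\<close>: writing \<open>x\<close> as
  \<open>T k (U k x)\<close> bounds the distance of \<open>T k (V x)\<close> from \<open>x\<close>
  by \<open>L * dist (V x) (U k x)\<close>, which tends to 0.\<close>

lemma inverse_limit:
  assumes T: "\<And>k. cube_map L (T k)" and inv: "\<And>k x. T k (U k x) = x"
    and lim: "\<And>x. (\<lambda>k. T k x) \<longlonglongrightarrow> R x" "\<And>x. (\<lambda>k. U k x) \<longlonglongrightarrow> V x"
  shows "R (V x) = x"
proof -
  have "(\<lambda>k. L * dist (V x) (U k x)) \<longlonglongrightarrow> L * dist (V x) (V x)"
    by (intro tendsto_intros lim)
  then have "(\<lambda>k. L * dist (V x) (U k x)) \<longlonglongrightarrow> 0"
    by simp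
  then have "(\<lambda>k. dist (T k (V x)) x) \<longlonglongrightarrow> 0"
  proof (rule tendsto_sandwich[OF _ _ tendsto_const, rotated 2])
    show "\<forall>\<^sub>F k in sequentially. dist (T k (V x)) x \<le> L * dist (V x) (U k x)"
      using T inv unfolding cube_map_def by (intro always_eventually) metis
  qed simp
  then have "(\<lambda>k. T k (V x)) \<longlonglongrightarrow> x"
    by (rule iffD2[OF tendsto_dist_iff])
  with lim(1)[of "V x"] show ?thesis
    by (rule LIMSEQ_unique)
qed

section \<open>Reflection and transport on the cube\<close>

lemma sum_powr_le:
  fixes \<alpha> :: real
  assumes "0 < \<alpha>"
  shows "(\<Sum>j<k. ((1 / 2) ^ j) powr \<alpha>) \<le> 1 / (1 - (1 / 2) powr \<alpha>)"
proof -
  let ?z = "(1 / 2 :: real) powr \<alpha>"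
  have z: "?z < 1" "0 \<le> ?z"
    using powr_less_mono'[of "1/2" 0 \<alpha>] assms by auto
  have "((1 / 2) ^ j) powr \<alpha> = ?z ^ j" for j
    by (simp add: powr_powr mult.commute flip: powr_realpow)
  then have "(\<Sum>j<k. ((1 / 2) ^ j) powr \<alpha>) = (\<Sum>j<k. ?z ^ j)"
    by simp
  also have "\<dots> \<le> (\<Sum>j. ?z ^ j)"
    by (rule sum_le_suminf) (use z in auto)
  also have "\<dots> = 1 / (1 - ?z)"
    by (rule suminf_geometric) (use z in auto)
  finally show ?thesis .
qed

text \<open>The factor 12 N^2, N being the dimension, comes from N coordinate steps per scale with
  exponent 12 N \<delta> r^\<alpha> each; the denominator sums the geometric series over
  \<open>r = (1/2)^k\<close>.\<close>

lemma periodic_transport: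
  fixes \<rho> :: "'a::euclidean_space \<Rightarrow> real" and \<delta> \<alpha> :: real
  assumes \<rho>: "holder_near_1 \<delta> \<alpha> \<rho>" and \<alpha>: "0 < \<alpha>" "\<alpha> \<le> 1" and \<delta>: "0 \<le> \<delta>" "\<delta> \<le> 1/2"
    and even: "\<And>b x. b \<in> Basis \<Longrightarrow> \<rho> (x - (2 * (x \<bullet> b)) *\<^sub>R b) = \<rho> x"
    and per: "\<And>b x. b \<in> Basis \<Longrightarrow> \<rho> (x + 2 *\<^sub>R b) = \<rho> x"
    and mass: "emeasure (cube_measure \<rho>) UNIV = 1"
  defines "L \<equiv> exp (12 * (real DIM('a))\<^sup>2 * \<delta> / (1 - (1 / 2) powr \<alpha>))"
  shows "\<exists>T U. cube_map L T \<and> cube_map L U \<and> (\<forall>x. U (T x) = x) \<and> (\<forall>x. T (U x) = x) \<and>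
    distr (cube_measure \<rho>) borel T = cube_measure (\<lambda>_. 1)"
proof -
  let ?N = "real DIM('a)" and ?h = "\<lambda>k::nat. (1 / 2 :: real) ^ k"
  let ?K = "12 * ?N\<^sup>2 * \<delta>"
  obtain bs where bs: "distinct bs" "set bs = (Basis :: 'a set)"
    using finite_distinct_list[OF finite_Basis] by blast
  define p where "p k = foldr (avg (?h k)) bs \<rho>" for k
  have p: "holder_near_1 \<delta> \<alpha> (p k)" for k
    unfolding p_def by (rule holder_near_1_foldr[OF \<rho> \<alpha>(1)]) simp
  have "\<exists>S S'. transports (exp (?K * ?h k powr \<alpha>)) (2 * ?N * ?h k) S S' (p (Suc k)) (p k)" for k
    using smoothing_transport[where \<rho>=\<rho> and r="?h k", OF \<rho> \<alpha> \<delta> _ even per bs]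
    by (simp add: p_def mult_ac)
  then obtain S S' where S: "\<And>k. transports (exp (?K * ?h k powr \<alpha>)) (2 * ?N * ?h k) (S k) (S' k) (p (Suc k)) (p k)"
    by metis
  \<comment> \<open>\<open>S k\<close> leads from \<open>p (Suc k)\<close> to \<open>p k\<close>, so
    new maps enter \<open>T\<close> innermost and \<open>U\<close> outermost. The change of
    \<open>T\<close> is therefore a displacement magnified by at most \<open>L\<close>, that of
    \<open>U\<close> a bare displacement.\<close>
  define T where "T = rec_nat id (\<lambda>k t. t \<circ> S k)"
  define U where "U = rec_nat id (\<lambda>k t. S' k \<circ> t)"
  have T_Suc: "T (Suc k) = T k \<circ> S k" and U_Suc: "U (Suc k) = S' k \<circ> U k" for k
    by (simp_all add: T_def U_def)
  have TU: "transports (exp (\<Sum>j<k. ?K * ?h j powr \<alpha>)) (\<Sum>j<k. 2 * ?N * ?h j) (T k) (U k) (p k) (p 0)" for k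
  proof (induction k)
    case 0
    show ?case
      using transports_id[of "p 0"] by (simp add: T_def U_def id_def)
  next
    case (Suc k)
    show ?case
      using transports_comp[OF Suc S[of k]] by (simp add: T_Suc U_Suc exp_add comp_def)
  qed
  have L_ge: "exp (\<Sum>j<k. ?K * ?h j powr \<alpha>) \<le> L" for k
  proof -
    have "(\<Sum>j<k. ?K * ?h j powr \<alpha>) = ?K * (\<Sum>j<k. ?h j powr \<alpha>)"
      by (simp add: sum_distrib_left)
    also have "\<dots> \<le> ?K * (1 / (1 - (1 / 2) powr \<alpha>))"
      by (intro mult_left_mono sum_powr_le \<alpha>) (use \<delta> in auto)
    finally show ?thesis by (simp add: L_def)
  qed
  have TU_map: "cube_map L (T k)" "cube_map L (U k)" for k
    using TU[of k] L_ge[of k] cube_map_mono unfolding transports_def by blast+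
  have inv: "U k (T k x) = x" "T k (U k x) = x" for k x
    using TU[of k] by (auto simp: transports_def)
  have push: "distr (cube_measure (p k)) borel (T k) = cube_measure (p 0)" for k
    using TU[of k] by (auto simp: transports_def)
  have S_dist: "dist (S k x) x \<le> 2 * ?N * ?h k" "dist (S' k x) x \<le> 2 * ?N * ?h k" for k x
    using S[of k] by (auto simp: transports_def)
  have "convergent (\<lambda>k. T k x)" for x
  proof (rule convergent_of_geometric_steps)
    fix k
    have "dist (T (Suc k) x) (T k x) \<le> L * dist (S k x) x"
      using TU_map(1)[of k] by (simp add: T_Suc cube_map_def)
    also have "\<dots> \<le> L * (2 * ?N * ?h k)"
      by (intro mult_left_mono S_dist) (simp add: L_def)
    finally show "dist (T (Suc k) x) (T k x) \<le> (L * (2 * ?N)) * (1 / 2) ^ k"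
      by (simp only: mult.assoc)
  qed
  then obtain R where R: "\<And>x. (\<lambda>k. T k x) \<longlonglongrightarrow> R x"
    unfolding convergent_def by metis
  have "convergent (\<lambda>k. U k x)" for x
  proof (rule convergent_of_geometric_steps)
    show "dist (U (Suc k) x) (U k x) \<le> (2 * ?N) * (1 / 2) ^ k" for k
      using S_dist(2) by (simp add: U_Suc)
  qed
  then obtain V where V: "\<And>x. (\<lambda>k. U k x) \<longlonglongrightarrow> V x"
    unfolding convergent_def by metis
  have R_map: "cube_map L R" and V_map: "cube_map L V"
    using cube_map_limit[OF TU_map(1) R] cube_map_limit[OF TU_map(2) V] by auto
  have p_lim: "(\<lambda>k. p k x) \<longlonglongrightarrow> \<rho> x" for x
  proof -
    have "(\<lambda>k. ?h k powr \<alpha>) \<longlonglongrightarrow> 0"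
      by (rule tendsto_zero_powrI[OF _ tendsto_const]) (use \<alpha> in \<open>auto intro: LIMSEQ_realpow_zero\<close>)
    then have lim: "(\<lambda>k. length bs * (\<delta> * ?h k powr \<alpha>)) \<longlonglongrightarrow> 0"
      by (intro tendsto_mult_right_zero)
    have "norm (p k x - \<rho> x) \<le> length bs * (\<delta> * ?h k powr \<alpha>)" for k
      unfolding p_def real_norm_def by (rule foldr_avg_near[OF \<rho> \<alpha>(1) _ \<delta>(1)]) (use bs in auto)
    then have "(\<lambda>k. p k x - \<rho> x) \<longlonglongrightarrow> 0"
      by (rule Lim_null_comparison[OF always_eventually[OF allI] lim])
    then show ?thesis by (simp add: LIM_zero_iff)
  qed
  have p_bounds: "1 / 2 \<le> p k x" "p k x \<le> 2" for k x
  proof -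
    have "\<bar>p k x - 1\<bar> \<le> \<delta>"
      using p by (simp add: holder_near_1_def)
    then show "1 / 2 \<le> p k x" "p k x \<le> 2"
      using \<delta> by (auto simp: abs_le_iff)
  qed
  have push_R: "distr (cube_measure \<rho>) borel R = cube_measure (p 0)"
  proof (rule cube_measure_limit[where p=p and T=T])
    show "continuous_on UNIV (p k)" for k
      by (rule holder_near_1_continuous[OF p \<alpha>(1)])
    show "continuous_on UNIV \<rho>"
      by (rule holder_near_1_continuous[OF \<rho> \<alpha>(1)])
    show "0 \<le> p k x" for k x
      using p_bounds(1)[of k x] by simp
  qed (use p_bounds(2) cube_map_continuous[OF TU_map(1)] cube_map_continuous[OF R_map] p_lim R push in auto)
  have p0: "p 0 = (\<lambda>_. p 0 0)"
    using foldr_avg_1_const[where f=\<rho>, OF \<rho> \<alpha>(1) bs(2) per] by (intro ext) (simp add: p_def)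
  \<comment> \<open>The coarsest density is constant, and conservation of the total mass identifies
    the constant as 1.\<close>
  have "1 = emeasure (distr (cube_measure \<rho>) borel R) UNIV"
    using cube_map_continuous[OF R_map, of UNIV] mass
    by (subst emeasure_distr) (auto intro: borel_measurable_continuous_onI)
  also have "\<dots> = emeasure (cube_measure (\<lambda>_::'a. p 0 0)) UNIV"
    using push_R p0 by metis
  also have "\<dots> = ennreal (p 0 0)"
    by (subst emeasure_cube_measure) (auto simp: nn_integral_cmult emeasure_cube)
  finally have "ennreal (p 0 0) = 1" ..
  then have "p 0 0 = 1" by simp
  then have "distr (cube_measure \<rho>) borel R = cube_measure (\<lambda>_. 1)"
    using push_R p0 by metis
  moreover have "V (R x) = x" "R (V x) = x" for x
    using inverse_limit[OF TU_map(1) inv(2) R V] inverse_limit[OF TU_map(2) inv(1) V R] by auto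
  ultimately show ?thesis
    using R_map V_map by blast
qed

text \<open>The triangle wave, as distance to the even integers: it is 1-Lipschitz like every
  distance function, and its symmetries are the isometries preserving the even integers.\<close>

definition fold_unit :: "real \<Rightarrow> real" where
  "fold_unit s = infdist s (range (\<lambda>k::int. 2 * of_int k))"

lemma fold_unit_isometry:
  assumes "\<And>s t :: real. dist (\<phi> s) (\<phi> t) = dist s t"
    and "\<phi> ` range (\<lambda>k::int. 2 * of_int k) = range (\<lambda>k::int. 2 * of_int k)"
  shows "fold_unit (\<phi> s) = fold_unit s"
proof -
  have "fold_unit (\<phi> s) = infdist (\<phi> s) (\<phi> ` range (\<lambda>k::int. 2 * of_int k))"
    by (simp only: fold_unit_def assms(2))
  also have "\<dots> = fold_unit s"
    unfolding fold_unit_def infdist_def image_image assms(1) by simp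
  finally show ?thesis .
qed

lemma fold_unit_minus: "fold_unit (- s) = fold_unit s"
proof (rule fold_unit_isometry)
  let ?f = "\<lambda>k::int. 2 * real_of_int k"
  have "uminus ` range ?f = ?f ` range uminus"
    unfolding image_image by (rule image_cong) simp_all
  also have "range (uminus :: int \<Rightarrow> int) = UNIV"
    by (metis minus_minus surj_def)
  finally show "uminus ` range ?f = range ?f" .
qed (simp add: dist_real_def abs_minus_commute)

lemma fold_unit_add_2: "fold_unit (s + 2) = fold_unit s"
proof (rule fold_unit_isometry[where \<phi>="\<lambda>s. s + 2"])
  let ?f = "\<lambda>k::int. 2 * real_of_int k"
  have "(\<lambda>s. s + 2) ` range ?f = ?f ` range (\<lambda>k. k + 1)"
    unfolding image_image by (rule image_cong) simp_all
  also have "range (\<lambda>k::int. k + 1) = UNIV"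
    by (metis diff_add_cancel surj_def)
  finally show "(\<lambda>s. s + 2) ` range ?f = range ?f" .
qed simp

lemma fold_unit_lipschitz: "\<bar>fold_unit s - fold_unit t\<bar> \<le> \<bar>s - t\<bar>"
  unfolding fold_unit_def using infdist_triangle_abs[of s _ t] by (simp add: dist_real_def)

lemma fold_unit_bounds: "0 \<le> fold_unit s" "fold_unit s \<le> 1"
proof -
  show "0 \<le> fold_unit s"
    by (simp add: fold_unit_def infdist_nonneg)
  \<comment> \<open>\<open>2 * k\<close> is an even integer nearest to \<open>s\<close>.\<close>
  define k where "k = \<lfloor>(s + 1) / 2\<rfloor>"
  have "of_int k \<le> (s + 1) / 2 \<and> (s + 1) / 2 < of_int k + 1"
    unfolding k_def using floor_correct[of "(s + 1) / 2"] by (simp only: of_int_add of_int_1)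
  then have "dist s (2 * of_int k) \<le> 1"
    by (simp add: dist_real_def abs_le_iff)
  then show "fold_unit s \<le> 1"
    unfolding fold_unit_def by (rule infdist_le2[rotated]) blast
qed

lemma fold_unit_id:
  assumes "0 \<le> s" "s \<le> 1"
  shows "fold_unit s = s"
proof (rule antisym)
  have "dist s (2 * of_int 0) \<le> s"
    using assms by simp
  then show "fold_unit s \<le> s"
    unfolding fold_unit_def by (rule infdist_le2[rotated]) blast
  have "fold_unit s = (INF a\<in>range (\<lambda>k::int. 2 * of_int k). dist s a)"
    by (simp add: fold_unit_def infdist_def)
  also have "s \<le> \<dots>"
  proof (rule cINF_greatest)
    fix a :: real
    assume "a \<in> range (\<lambda>k::int. 2 * of_int k)"
    then obtain k :: int where a: "a = 2 * of_int k" by blast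
    consider "k \<le> 0" | "k \<ge> 1" by linarith
    then have "real_of_int k \<le> 0 \<or> real_of_int k \<ge> 1"
      by cases auto
    then show "s \<le> dist s a"
      using assms by (auto simp: dist_real_def a)
  qed simp
  finally show "s \<le> fold_unit s" .
qed

definition fold_cube :: "'a::euclidean_space \<Rightarrow> 'a" where
  "fold_cube x = (\<Sum>b\<in>Basis. fold_unit (x \<bullet> b) *\<^sub>R b)"

lemma fold_cube_inner: "b \<in> Basis \<Longrightarrow> fold_cube x \<bullet> b = fold_unit (x \<bullet> b)"
  by (simp add: fold_cube_def)

lemma fold_cube_in: "fold_cube x \<in> cbox 0 One"
  by (simp add: mem_cbox_One fold_cube_inner fold_unit_bounds)

lemma fold_cube_id: "x \<in> cbox 0 One \<Longrightarrow> fold_cube x = x"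
  by (rule euclidean_eqI) (simp add: mem_cbox_One fold_cube_inner fold_unit_id)

lemma fold_cube_lipschitz: "norm (fold_cube y - fold_cube x) \<le> norm (y - x)"
  by (rule norm_le_componentwise) (simp add: inner_diff_left fold_cube_inner fold_unit_lipschitz)

lemma fold_cube_reflection:
  assumes "b \<in> Basis"
  shows "fold_cube (x - (2 * (x \<bullet> b)) *\<^sub>R b) = fold_cube x"
proof (rule euclidean_eqI)
  fix c :: 'a
  assume "c \<in> Basis"
  with assms show "fold_cube (x - (2 * (x \<bullet> b)) *\<^sub>R b) \<bullet> c = fold_cube x \<bullet> c"
    using fold_unit_minus[of "x \<bullet> b"]
    by (cases "c = b") (simp_all add: fold_cube_inner inner_diff_left inner_not_same_Basis)
qed

lemma fold_cube_periodic:
  assumes "b \<in> Basis"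
  shows "fold_cube (x + 2 *\<^sub>R b) = fold_cube x"
proof (rule euclidean_eqI)
  fix c :: 'a
  assume "c \<in> Basis"
  with assms show "fold_cube (x + 2 *\<^sub>R b) \<bullet> c = fold_cube x \<bullet> c"
    using fold_unit_add_2[of "x \<bullet> b"]
    by (cases "c = b") (simp_all add: fold_cube_inner inner_left_distrib inner_not_same_Basis)
qed

text \<open>Composing with \<open>fold_cube\<close> extends \<open>g\<close> evenly and
  2-periodically without changing it on the cube. Since \<open>fold_cube\<close> is 1-Lipschitz, the
  extension is Hoelder with the same \<delta>.\<close>

lemma cube_transport:
  fixes g :: "'a::euclidean_space \<Rightarrow> real" and \<delta> \<alpha> :: real
  assumes \<alpha>: "0 < \<alpha>" "\<alpha> \<le> 1" and \<delta>: "0 \<le> \<delta>" "\<delta> \<le> 1/2"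
    and near: "\<And>x. x \<in> cbox 0 One \<Longrightarrow> \<bar>g x - 1\<bar> \<le> \<delta>"
    and holder: "\<And>x y. x \<in> cbox 0 One \<Longrightarrow> y \<in> cbox 0 One \<Longrightarrow> \<bar>g y - g x\<bar> \<le> \<delta> * norm (y - x) powr \<alpha>"
    and mass: "(\<integral>\<^sup>+x. ennreal (g x) * indicator (cbox 0 One) x \<partial>lborel) = 1"
  defines "L \<equiv> exp (12 * (real DIM('a))\<^sup>2 * \<delta> / (1 - (1 / 2) powr \<alpha>))"
  shows "\<exists>T U. cube_map L T \<and> cube_map L U \<and> (\<forall>x. U (T x) = x) \<and> (\<forall>x. T (U x) = x) \<and>
    (\<forall>A\<in>sets borel. (\<integral>\<^sup>+x. ennreal (g x) * indicator (cbox 0 One) x * indicator A (T x) \<partial>lborel)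
        = emeasure lborel (cbox 0 One \<inter> A))"
proof -
  define \<rho> where "\<rho> x = g (fold_cube x)" for x
  have \<rho>: "ennreal (\<rho> x) * indicator (cbox 0 One) x = ennreal (g x) * indicator (cbox 0 One) x" for x
    by (auto simp: indicator_def \<rho>_def fold_cube_id)
  have h: "holder_near_1 \<delta> \<alpha> \<rho>"
    unfolding holder_near_1_def \<rho>_def
  proof (intro conjI allI near fold_cube_in)
    fix x v :: 'a
    have "\<bar>g (fold_cube (x + v)) - g (fold_cube x)\<bar> \<le> \<delta> * norm (fold_cube (x + v) - fold_cube x) powr \<alpha>"
      by (rule holder) (rule fold_cube_in)+
    also have "\<dots> \<le> \<delta> * norm v powr \<alpha>"
      using fold_cube_lipschitz[of "x + v" x] \<alpha> \<delta> by (intro mult_left_mono powr_mono2) auto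
    finally show "\<bar>g (fold_cube (x + v)) - g (fold_cube x)\<bar> \<le> \<delta> * norm v powr \<alpha>" .
  qed
  have sym: "\<rho> (x - (2 * (x \<bullet> b)) *\<^sub>R b) = \<rho> x" "\<rho> (x + 2 *\<^sub>R b) = \<rho> x" if "b \<in> Basis" for b x
    using that by (simp_all add: \<rho>_def fold_cube_reflection fold_cube_periodic)
  note em = emeasure_cube_measure[OF holder_near_1_continuous[OF h \<alpha>(1)]]
  have m: "emeasure (cube_measure \<rho>) UNIV = 1"
    by (subst em) (simp_all add: \<rho> mass)
  obtain T U where T: "cube_map L T" "cube_map L U" "\<And>x. U (T x) = x" "\<And>x. T (U x) = x"
    and push: "distr (cube_measure \<rho>) borel T = cube_measure (\<lambda>_. 1)"
    using periodic_transport[where \<rho>=\<rho>, OF h \<alpha> \<delta> sym m] unfolding L_def by blast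
  have "(\<integral>\<^sup>+x. ennreal (g x) * indicator (cbox 0 One) x * indicator A (T x) \<partial>lborel)
      = emeasure lborel (cbox 0 One \<inter> A)" if A: "A \<in> sets borel" for A
  proof -
    have T_meas: "T \<in> borel_measurable borel"
      by (rule borel_measurable_continuous_onI[OF cube_map_continuous[OF T(1)]])
    have "emeasure (distr (cube_measure \<rho>) borel T) A = emeasure (cube_measure \<rho>) (T -` A)"
      using A T_meas by (subst emeasure_distr) auto
    also have "\<dots> = (\<integral>\<^sup>+x. ennreal (g x) * indicator (cbox 0 One) x * indicator A (T x) \<partial>lborel)"
      using measurable_sets[OF T_meas A] by (subst em) (simp_all add: \<rho> indicator_vimage)
    finally have "(\<integral>\<^sup>+x. ennreal (g x) * indicator (cbox 0 One) x * indicator A (T x) \<partial>lborel)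
        = emeasure (cube_measure (\<lambda>_. 1)) A"
      unfolding push ..
    also have "\<dots> = (\<integral>\<^sup>+x. ennreal 1 * indicator (cbox 0 One) x * indicator A x \<partial>lborel)"
      by (rule emeasure_cube_measure[OF continuous_on_const A])
    also have "\<dots> = (\<integral>\<^sup>+x. indicator (cbox 0 One \<inter> A) x \<partial>lborel)"
      by (rule nn_integral_cong) (auto simp: indicator_def)
    also have "\<dots> = emeasure lborel (cbox 0 One \<inter> A)"
      using A by (intro nn_integral_indicator) auto
    finally show ?thesis .
  qed
  with T show ?thesis by blast
qed

section \<open>Extension to the closed cube\<close>

text \<open>Folding takes values on the closed cube, whereas the density is given on the open one.
  Uniform continuity supplies the extension, and both estimates pass to the limit with unchanged
  constants.\<close>

lemma holder_extension:
  fixes f :: "'a::euclidean_space \<Rightarrow> real"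
  assumes \<alpha>: "0 < \<alpha>" and \<delta>: "0 \<le> \<delta>"
    and near: "\<And>x. x \<in> box 0 One \<Longrightarrow> \<bar>f x - 1\<bar> \<le> \<delta>"
    and holder: "\<And>x y. x \<in> box 0 One \<Longrightarrow> y \<in> box 0 One \<Longrightarrow> \<bar>f y - f x\<bar> \<le> \<delta> * norm (y - x) powr \<alpha>"
  obtains g where "\<And>x. x \<in> box 0 One \<Longrightarrow> g x = f x" and "continuous_on (cbox 0 One) g"
    and "\<And>x. x \<in> cbox 0 One \<Longrightarrow> \<bar>g x - 1\<bar> \<le> \<delta>"
    and "\<And>x y. x \<in> cbox 0 One \<Longrightarrow> y \<in> cbox 0 One \<Longrightarrow> \<bar>g y - g x\<bar> \<le> \<delta> * norm (y - x) powr \<alpha>"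
proof -
  have "uniformly_continuous_on (box 0 One) f"
    unfolding uniformly_continuous_on_def
  proof (intro allI impI)
    fix e :: real
    assume e: "e > 0"
    \<comment> \<open>Chosen so that \<delta> d^\<alpha> < e; the summand 1 covers \<delta> =
      0.\<close>
    define d where "d = (e / (\<delta> + 1)) powr (1 / \<alpha>)"
    have d: "d > 0" "d powr \<alpha> = e / (\<delta> + 1)"
      using e \<delta> \<alpha> by (simp_all add: d_def powr_powr)
    have "dist (f y) (f x) < e" if "x \<in> box 0 One" "y \<in> box 0 One" "dist y x < d" for x y
    proof -
      have "dist (f y) (f x) \<le> \<delta> * norm (y - x) powr \<alpha>"
        using holder that by (simp add: dist_real_def)
      also have "\<dots> \<le> \<delta> * d powr \<alpha>"
        using that \<alpha> \<delta> by (intro mult_left_mono powr_mono2) (auto simp: dist_norm)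
      also have "\<dots> = \<delta> / (\<delta> + 1) * e"
        by (simp add: d(2))
      also have "\<dots> < 1 * e"
        using e \<delta> by (intro mult_strict_right_mono) auto
      finally show ?thesis by simp
    qed
    with d(1) show "\<exists>d>0. \<forall>x\<in>box 0 One. \<forall>y\<in>box 0 One. dist y x < d \<longrightarrow> dist (f y) (f x) < e"
      by blast
  qed
  then obtain g where g: "uniformly_continuous_on (closure (box 0 One)) g" "\<And>x. x \<in> box 0 One \<Longrightarrow> f x = g x"
    by (rule uniformly_continuous_on_extension_on_closure) blast
  have cl: "closure (box 0 (One::'a)) = cbox 0 One"
    by (rule closure_box) (simp add: box_ne_empty)
  have cont: "continuous_on (cbox 0 One) g"
    using g(1) unfolding cl by (rule uniformly_continuous_imp_continuous)
  define h where "h n = inverse (real (Suc n))" for n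
  \<comment> \<open>Contraction towards the centre of the cube: it maps the closed cube into the
    open one, tends to the identity and does not increase distances.\<close>
  define w where "w n x = (1 - h n) *\<^sub>R x + (h n / 2) *\<^sub>R One" for n and x :: 'a
  have h: "0 < h n" "h n \<le> 1" for n
    by (auto simp: h_def field_simps)
  have w_in: "w n x \<in> box 0 One" if "x \<in> cbox 0 One" for n x
    unfolding mem_box
  proof (intro ballI)
    fix c :: 'a
    assume c: "c \<in> Basis"
    then have x: "0 \<le> x \<bullet> c" "x \<bullet> c \<le> 1"
      using that by (auto simp: mem_cbox_One)
    have "w n x \<bullet> c = (1 - h n) * (x \<bullet> c) + h n / 2"
      using c by (simp add: w_def inner_left_distrib)
    moreover have "0 \<le> (1 - h n) * (x \<bullet> c)"
      using h[of n] x by simp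
    moreover have "(1 - h n) * (x \<bullet> c) \<le> (1 - h n) * 1"
      by (rule mult_left_mono) (use h[of n] x in auto)
    ultimately show "0 \<bullet> c < w n x \<bullet> c \<and> w n x \<bullet> c < One \<bullet> c"
      using h[of n] c by simp
  qed
  have w_lim: "(\<lambda>n. g (w n x)) \<longlonglongrightarrow> g x" if "x \<in> cbox 0 One" for x
  proof (rule continuous_on_tendsto_compose[OF cont _ that])
    have "h \<longlonglongrightarrow> 0"
      unfolding h_def[abs_def] by (rule LIMSEQ_inverse_real_of_nat)
    then have "(\<lambda>n. w n x) \<longlonglongrightarrow> (1 - 0) *\<^sub>R x + (0 / 2) *\<^sub>R One"
      unfolding w_def by (intro tendsto_intros) auto
    then show "(\<lambda>n. w n x) \<longlonglongrightarrow> x"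
      by simp
    show "\<forall>\<^sub>F n in sequentially. w n x \<in> cbox 0 One"
      using w_in[OF that] box_subset_cbox by (intro always_eventually) blast
  qed
  show ?thesis
  proof (rule that[OF _ cont])
    show "g x = f x" if "x \<in> box 0 One" for x
      using g(2)[OF that] by simp
    show "\<bar>g x - 1\<bar> \<le> \<delta>" if x: "x \<in> cbox 0 One" for x
    proof (rule LIMSEQ_le_const2)
      show "(\<lambda>n. \<bar>g (w n x) - 1\<bar>) \<longlonglongrightarrow> \<bar>g x - 1\<bar>"
        by (intro tendsto_intros w_lim x)
      show "\<exists>N. \<forall>n\<ge>N. \<bar>g (w n x) - 1\<bar> \<le> \<delta>"
        using near[OF w_in[OF x]] g(2)[OF w_in[OF x]] by simp
    qed
    show "\<bar>g y - g x\<bar> \<le> \<delta> * norm (y - x) powr \<alpha>" if x: "x \<in> cbox 0 One" and y: "y \<in> cbox 0 One" for x y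
    proof (rule LIMSEQ_le_const2)
      show "(\<lambda>n. \<bar>g (w n y) - g (w n x)\<bar>) \<longlonglongrightarrow> \<bar>g y - g x\<bar>"
        by (intro tendsto_intros w_lim x y)
      have "\<bar>g (w n y) - g (w n x)\<bar> \<le> \<delta> * norm (y - x) powr \<alpha>" for n
      proof -
        have "w n y - w n x = (1 - h n) *\<^sub>R (y - x)"
          by (simp add: w_def scaleR_diff_right)
        then have "norm (w n y - w n x) = (1 - h n) * norm (y - x)"
          using h[of n] by simp
        also have "\<dots> \<le> 1 * norm (y - x)"
          using h[of n] by (intro mult_right_mono) auto
        finally have "norm (w n y - w n x) powr \<alpha> \<le> norm (y - x) powr \<alpha>"
          using \<alpha> by (intro powr_mono2) auto
        then have "\<delta> * norm (w n y - w n x) powr \<alpha> \<le> \<delta> * norm (y - x) powr \<alpha>"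
          by (rule mult_left_mono[OF _ \<delta>])
        then show ?thesis
          using holder[OF w_in[OF x] w_in[OF y], of n n] g(2)[OF w_in[OF x]] g(2)[OF w_in[OF y]]
          by simp
      qed
      then show "\<exists>N. \<forall>n\<ge>N. \<bar>g (w n y) - g (w n x)\<bar> \<le> \<delta> * norm (y - x) powr \<alpha>"
        by blast
    qed
  qed
qed

section \<open>Return to the open cube and to the norms of the statement\<close>

lemma mem_box_One: "x \<in> box 0 One \<longleftrightarrow> (\<forall>c\<in>Basis. 0 < x \<bullet> c \<and> x \<bullet> c < 1)"
  by (auto simp: mem_box)

lemma cube_map_cbox: "cube_map L T \<Longrightarrow> x \<in> cbox 0 One \<Longrightarrow> T x \<in> cbox 0 One"
  by (auto simp: cube_map_def mem_cbox_One)

text \<open>If \<open>T x\<close> lay on a face, \<open>U\<close> would keep the corresponding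
  coordinate, and \<open>x = U (T x)\<close> would lie on that face too.\<close>

lemma cube_map_box:
  assumes T: "cube_map L T" and U: "cube_map M U" "U (T x) = x" and x: "x \<in> box 0 One"
  shows "T x \<in> box 0 One"
  unfolding mem_box_One
proof
  fix c :: 'a
  assume c: "c \<in> Basis"
  have "0 \<le> T x \<bullet> c \<and> T x \<bullet> c \<le> 1"
    using cube_map_cbox[OF T subsetD[OF box_subset_cbox x]] c by (simp add: mem_cbox_One)
  moreover have "T x \<bullet> c \<noteq> 0 \<and> T x \<bullet> c \<noteq> 1"
  proof (rule ccontr)
    assume *: "\<not> (T x \<bullet> c \<noteq> 0 \<and> T x \<bullet> c \<noteq> 1)"
    then have "U (T x) \<bullet> c = T x \<bullet> c"
      using U(1) c unfolding cube_map_def by blast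
    with * x c show False
      by (auto simp: U(2) mem_box_One)
  qed
  ultimately show "0 < T x \<bullet> c \<and> T x \<bullet> c < 1" by auto
qed

lemma Lip_le:
  assumes "\<And>x y. x \<in> S \<Longrightarrow> y \<in> S \<Longrightarrow> dist (f x) (f y) \<le> L * dist x y"
  shows "Lip S f \<le> ennreal L"
  unfolding Lip_def
proof (rule SUP_least, clarify)
  fix x y
  assume "x \<in> S" "y \<in> S" "x \<noteq> y"
  then show "ennreal (dist (f x) (f y) / dist x y) \<le> ennreal L"
    using assms[of x y] by (intro ennreal_leI) (simp add: divide_le_eq)
qed

lemma holder_norm_bounds:
  assumes "holder_norm \<alpha> S f \<le> ennreal \<delta>" "0 \<le> \<delta>" "x \<in> S"
  shows "\<bar>f x\<bar> \<le> \<delta>" "y \<in> S \<Longrightarrow> \<bar>f y - f x\<bar> \<le> \<delta> * dist x y powr \<alpha>"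
proof -
  have "ennreal \<bar>f x\<bar> \<le> (SUP x\<in>S. ennreal \<bar>f x\<bar>)"
    using assms(3) by (rule SUP_upper)
  also have "\<dots> \<le> holder_norm \<alpha> S f"
    unfolding holder_norm_def by simp
  also note assms(1)
  finally show "\<bar>f x\<bar> \<le> \<delta>"
    using assms(2) by simp
  assume y: "y \<in> S"
  show "\<bar>f y - f x\<bar> \<le> \<delta> * dist x y powr \<alpha>"
  proof (cases "x = y")
    case False
    then have "ennreal (\<bar>f y - f x\<bar> / dist x y powr \<alpha>) \<le>
      (SUP (x, y)\<in>{(x, y). x \<in> S \<and> y \<in> S \<and> x \<noteq> y}. ennreal (\<bar>f y - f x\<bar> / dist x y powr \<alpha>))"
      using y assms(3) by (intro SUP_upper2[of "(x, y)"]) auto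
    also have "\<dots> \<le> holder_norm \<alpha> S f"
      unfolding holder_norm_def by simp
    also note assms(1)
    finally have "\<bar>f y - f x\<bar> / dist x y powr \<alpha> \<le> \<delta>"
      using assms(2) by simp
    with False show ?thesis
      by (simp add: pos_divide_le_eq)
  qed (use assms in simp)
qed

text \<open>Multiplying 1 - x \<le> exp (- x) by exp x gives exp x \<le> 1 + x exp x, and x = K
  \<delta> is at most K / 2 in the last exponential. This turns the exponential Lipschitz bound into
  a linear one.\<close>

lemma exp_le_one_plus:
  assumes "0 \<le> K" "0 \<le> \<delta>" "\<delta> \<le> 1 / 2"
  shows "exp (K * \<delta>) \<le> 1 + K * exp (K / 2) * (\<delta> :: real)"
proof -
  let ?x = "K * \<delta>"
  have "(1 - ?x) * exp ?x \<le> exp (- ?x) * exp ?x"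
    using exp_ge_add_one_self[of "- ?x"] by (intro mult_right_mono) auto
  then have "exp ?x \<le> 1 + ?x * exp ?x"
    by (simp add: algebra_simps flip: exp_add)
  also have "?x * exp ?x \<le> ?x * exp (K / 2)"
    using assms mult_left_mono[of \<delta> "1/2" K] by (intro mult_left_mono) auto
  finally show ?thesis
    by (simp add: mult_ac)
qed

text \<open>Links the vector 1 in \<open>open_cube\<close> with the sum of basis vectors used for
  general Euclidean spaces.\<close>

lemma one_eq_One: "(1 :: real ^ 'n) = One"
proof (rule euclidean_eqI)
  fix b :: "real ^ 'n"
  assume b: "b \<in> Basis"
  then obtain i where "b = axis i 1"
    by (auto simp: Basis_vec_def)
  then have "1 \<bullet> b = (1::real)"
    by (simp add: inner_axis)
  with b show "1 \<bullet> b = One \<bullet> b" by simp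
qed

lemma AE_cbox_box: "AE x in lborel. (x :: 'a::euclidean_space) \<in> cbox a b \<longrightarrow> x \<in> box a b"
proof (rule AE_I)
  show "{x \<in> space lborel. \<not> (x \<in> cbox a b \<longrightarrow> x \<in> box a b)} \<subseteq> cbox a b - box a b"
    by auto
  show "emeasure lborel (cbox a b - box a b) = 0"
    using box_subset_cbox[of a b]
    by (subst emeasure_Diff) (auto simp: emeasure_lborel_box_eq emeasure_lborel_cbox_eq)
qed auto

text \<open>\<open>T\<close> preserves the open cube in both directions, so for \<open>A\<close>
  inside it the integrands over the open and the closed cube agree at every point.\<close>

lemma distr_density_box:
  fixes f g :: "real ^ 'n \<Rightarrow> real" and T :: "real ^ 'n \<Rightarrow> real ^ 'n"
  assumes f: "continuous_on (box 0 One) f" and gf: "\<And>x. x \<in> box 0 One \<Longrightarrow> g x = f x"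
    and T: "continuous_on UNIV T" "\<And>x. T x \<in> box 0 One \<longleftrightarrow> x \<in> box 0 One"
    and push: "\<And>A. A \<in> sets borel \<Longrightarrow>
      (\<integral>\<^sup>+x. ennreal (g x) * indicator (cbox 0 One) x * indicator A (T x) \<partial>lborel) = emeasure lborel (cbox 0 One \<inter> A)"
  shows "T \<in> restrict_space borel (box 0 One) \<rightarrow>\<^sub>M restrict_space borel (box 0 One)"
    and "distr (density_measure (box 0 One) f) (restrict_space lborel (box 0 One)) T
      = restrict_space lborel (box 0 One)"
proof -
  let ?B = "box 0 One :: (real ^ 'n) set" and ?C = "cbox 0 One :: (real ^ 'n) set"
  show meas: "T \<in> restrict_space borel ?B \<rightarrow>\<^sub>M restrict_space borel ?B"
    using T by (intro measurable_restrict_space3 borel_measurable_continuous_onI) auto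
  have sets: "sets (restrict_space lborel ?B) = sets (restrict_space borel ?B)"
    by (rule sets_restrict_space_cong) simp
  have dsets: "sets (density_measure ?B f) = sets (restrict_space borel ?B)"
    by (simp add: density_measure_def sets)
  have T_meas: "T \<in> density_measure ?B f \<rightarrow>\<^sub>M restrict_space lborel ?B"
    using meas measurable_cong_sets[OF dsets sets] by blast
  have f_meas: "f \<in> borel_measurable (restrict_space lborel ?B)"
    using borel_measurable_continuous_on_restrict[OF f] measurable_cong_sets[OF sets HOL.refl] by blast
  show "distr (density_measure ?B f) (restrict_space lborel ?B) T = restrict_space lborel ?B"
  proof (rule measure_eqI)
    fix A
    assume "A \<in> sets (distr (density_measure ?B f) (restrict_space lborel ?B) T)"
    then have A: "A \<in> sets (restrict_space lborel ?B)" by simp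
    then have A_borel: "A \<in> sets borel" and A_box: "A \<subseteq> ?B"
      by (auto simp: sets_restrict_space)
    have TA: "T -` A \<inter> ?B \<in> sets (restrict_space lborel ?B)"
      using measurable_sets[OF T_meas A] by (simp add: dsets sets density_measure_def space_restrict_space)
    have "emeasure (distr (density_measure ?B f) (restrict_space lborel ?B) T) A
        = emeasure (density_measure ?B f) (T -` A \<inter> ?B)"
      using A T_meas by (subst emeasure_distr) (auto simp: density_measure_def space_restrict_space)
    also have "\<dots> = (\<integral>\<^sup>+x. ennreal (f x) * indicator (T -` A \<inter> ?B) x \<partial>restrict_space lborel ?B)"
      unfolding density_measure_def using f_meas TA by (subst emeasure_density) auto
    also have "\<dots> = (\<integral>\<^sup>+x. ennreal (f x) * indicator (T -` A \<inter> ?B) x * indicator ?B x \<partial>lborel)"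
      by (rule nn_integral_restrict_space) simp
    also have "\<dots> = (\<integral>\<^sup>+x. ennreal (g x) * indicator ?C x * indicator A (T x) \<partial>lborel)"
    proof (rule nn_integral_cong)
      fix x
      show "ennreal (f x) * indicator (T -` A \<inter> ?B) x * indicator ?B x
          = ennreal (g x) * indicator ?C x * indicator A (T x)"
        using gf[of x] T(2)[of x] A_box box_subset_cbox[of 0 "One :: real ^ 'n"]
        by (auto simp: indicator_def)
    qed
    also have "\<dots> = emeasure lborel (?C \<inter> A)"
      by (rule push[OF A_borel])
    also have "?C \<inter> A = A"
      using A_box box_subset_cbox[of 0 "One :: real ^ 'n"] by auto
    also have "emeasure lborel A = emeasure (restrict_space lborel ?B) A"
      using A_box by (subst emeasure_restrict_space) auto
    finally show "emeasure (distr (density_measure ?B f) (restrict_space lborel ?B) T) A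
        = emeasure (restrict_space lborel ?B) A" .
  qed simp
qed

lemma frontier_box_One: "frontier (box 0 (One :: 'a::euclidean_space)) = cbox 0 One - box 0 One"
proof -
  have "closure (box 0 (One::'a)) = cbox 0 One"
    by (rule closure_box) (simp add: box_ne_empty)
  then show ?thesis
    by (simp add: frontier_def interior_open[OF open_box])
qed

theorem proposition2p4:
  fixes \<alpha> :: real
  assumes "0 < \<alpha>" and "\<alpha> \<le> 1"
  shows "\<exists>C>0. \<forall>\<rho> :: real ^ 'n \<Rightarrow> real.
    (\<forall>x\<in>open_cube. 0 < \<rho> x) \<and>
    (LINT x:open_cube|lborel. \<rho> x) = 1 \<and>
    holder_norm \<alpha> open_cube (\<lambda>x. \<rho> x - 1) \<le> ennreal (1 / 2) \<longrightarrow>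
    (\<exists>T :: real ^ 'n \<Rightarrow> real ^ 'n.
       bij_betw T open_cube open_cube \<and>
       T \<in> restrict_space borel open_cube \<rightarrow>\<^sub>M restrict_space borel open_cube \<and>
       distr (density_measure open_cube \<rho>) (restrict_space lborel open_cube) T
         = restrict_space lborel open_cube \<and>
       Lip open_cube T
         \<le> 1 + ennreal C * holder_norm \<alpha> open_cube (\<lambda>x. \<rho> x - 1) \<and>
       Lip open_cube (inv_into open_cube T)
         \<le> 1 + ennreal C * holder_norm \<alpha> open_cube (\<lambda>x. \<rho> x - 1) \<and>
       (\<exists>T'. continuous_on (closure open_cube) T' \<and>
             (\<forall>x\<in>open_cube. T' x = T x) \<and>
             T' ` frontier open_cube = frontier open_cube))"
proof -
  \<comment> \<open>\<open>K * \<delta>\<close> is the exponent in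
    \<open>periodic_transport\<close>; \<open>C\<close> is the constant that
    \<open>exp_le_one_plus\<close> attaches to it.\<close>
  define K where "K = 12 * (real DIM(real ^ 'n))\<^sup>2 / (1 - (1 / 2) powr \<alpha>)"
  define C where "C = K * exp (K / 2)"
  have "(1 / 2 :: real) powr \<alpha> < 1"
    using powr_less_mono'[of "1/2" 0 \<alpha>] assms by simp
  then have K: "K > 0"
    by (simp add: K_def)
  then have C: "C > 0"
    by (simp add: C_def)
  show ?thesis
    unfolding one_eq_One
  proof (intro exI[of _ C] conjI allI impI C, elim conjE)
    let ?B = "box 0 One :: (real ^ 'n) set" and ?C = "cbox 0 One :: (real ^ 'n) set"
    fix \<rho> :: "real ^ 'n \<Rightarrow> real"
    assume pos: "\<forall>x\<in>?B. 0 < \<rho> x" and mass: "(LINT x:?B|lborel. \<rho> x) = 1"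
      and norm: "holder_norm \<alpha> ?B (\<lambda>x. \<rho> x - 1) \<le> ennreal (1 / 2)"
    define \<delta> where "\<delta> = enn2real (holder_norm \<alpha> ?B (\<lambda>x. \<rho> x - 1))"
    have "holder_norm \<alpha> ?B (\<lambda>x. \<rho> x - 1) < top"
      by (rule le_less_trans[OF norm ennreal_less_top])
    then have \<delta>_eq: "holder_norm \<alpha> ?B (\<lambda>x. \<rho> x - 1) = ennreal \<delta>"
      by (simp add: \<delta>_def)
    have "ennreal \<delta> \<le> ennreal (1 / 2)"
      using norm unfolding \<delta>_eq .
    then have \<delta>: "0 \<le> \<delta>" "\<delta> \<le> 1/2"
      by (simp add: \<delta>_def, subst (asm) ennreal_le_iff) simp_all
    note bounds = holder_norm_bounds[OF eq_refl[OF \<delta>_eq] \<delta>(1)]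
    have near: "\<bar>\<rho> x - 1\<bar> \<le> \<delta>" if "x \<in> ?B" for x
      using bounds(1)[OF that] .
    have holder: "\<bar>\<rho> y - \<rho> x\<bar> \<le> \<delta> * norm (y - x) powr \<alpha>" if "x \<in> ?B" "y \<in> ?B" for x y
      using bounds(2)[OF that] by (simp add: dist_norm norm_minus_commute)
    obtain g where g: "\<And>x. x \<in> ?B \<Longrightarrow> g x = \<rho> x"
      and g_cont: "continuous_on ?C g"
      and g_near: "\<And>x. x \<in> ?C \<Longrightarrow> \<bar>g x - 1\<bar> \<le> \<delta>"
      and g_holder: "\<And>x y. x \<in> ?C \<Longrightarrow> y \<in> ?C \<Longrightarrow> \<bar>g y - g x\<bar> \<le> \<delta> * norm (y - x) powr \<alpha>"
      using holder_extension[where f=\<rho>, OF assms(1) \<delta>(1) near holder] by blast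
    \<comment> \<open>The Lebesgue integral of a non-integrable function is 0 by default, so mass 1
      forces integrability.\<close>
    have int: "integrable lborel (\<lambda>x. indicator ?B x *\<^sub>R \<rho> x)"
      using mass not_integrable_integral_eq[of lborel "\<lambda>x. indicator ?B x *\<^sub>R \<rho> x"]
      unfolding set_lebesgue_integral_def by fastforce
    have "(\<integral>\<^sup>+x. ennreal (g x) * indicator ?C x \<partial>lborel) = (\<integral>\<^sup>+x. ennreal (indicator ?B x *\<^sub>R \<rho> x) \<partial>lborel)"
    proof (rule nn_integral_cong_AE)
      show "AE x in lborel. ennreal (g x) * indicator ?C x = ennreal (indicator ?B x *\<^sub>R \<rho> x)"
        using AE_cbox_box[of 0 "One :: real ^ 'n"]
      proof eventually_elim
        case (elim x)
        then show ?case
          using g[of x] box_subset_cbox[of 0 "One :: real ^ 'n"] by (auto simp: indicator_def)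
      qed
    qed
    also have "\<dots> = ennreal (LINT x|lborel. indicator ?B x *\<^sub>R \<rho> x)"
      by (rule nn_integral_eq_integral[OF int]) (use pos in \<open>auto simp: indicator_def less_imp_le\<close>)
    also have "\<dots> = 1"
      using mass by (simp add: set_lebesgue_integral_def)
    finally have g_mass: "(\<integral>\<^sup>+x. ennreal (g x) * indicator ?C x \<partial>lborel) = 1" .
    define L where "L = exp (12 * (real DIM(real ^ 'n))\<^sup>2 * \<delta> / (1 - (1 / 2) powr \<alpha>))"
    obtain T U where T: "cube_map L T" and U: "cube_map L U"
      and inv: "\<And>x. U (T x) = x" "\<And>x. T (U x) = x"
      and push: "\<And>A. A \<in> sets borel \<Longrightarrow>
        (\<integral>\<^sup>+x. ennreal (g x) * indicator ?C x * indicator A (T x) \<partial>lborel) = emeasure lborel (?C \<inter> A)"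
      using cube_transport[where g=g, OF assms \<delta> g_near g_holder g_mass, folded L_def] by blast
    have T_box: "T x \<in> ?B \<longleftrightarrow> x \<in> ?B" for x
      using cube_map_box[OF T U inv(1), of x] cube_map_box[OF U T inv(2), of "T x"] inv(1)[of x] by auto
    have U_box: "U x \<in> ?B \<longleftrightarrow> x \<in> ?B" for x
      using T_box[of "U x"] inv(2)[of x] by simp
    have "continuous_on ?B \<rho>"
      using continuous_on_subset[OF g_cont box_subset_cbox] g by (simp cong: continuous_on_cong)
    have "L = exp (K * \<delta>)"
      by (simp add: L_def K_def)
    then have "L \<le> 1 + C * \<delta>"
      unfolding C_def using exp_le_one_plus[of K \<delta>] K \<delta> by simp
    then have "ennreal L \<le> ennreal (1 + C * \<delta>)"
      by (rule ennreal_leI)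
    also have "\<dots> = 1 + ennreal C * ennreal \<delta>"
      using C \<delta> by (simp add: ennreal_plus ennreal_mult)
    finally have L: "ennreal L \<le> 1 + ennreal C * holder_norm \<alpha> ?B (\<lambda>x. \<rho> x - 1)"
      unfolding \<delta>_eq .
    have inj: "inj_on T ?B"
      using inv(1) by (metis inj_onI)
    have U_inv: "inv_into ?B T x = U x" if "x \<in> ?B" for x
      using that by (intro inv_into_f_eq inj) (simp_all add: U_box inv)
    show "\<exists>T. bij_betw T ?B ?B \<and> T \<in> restrict_space borel ?B \<rightarrow>\<^sub>M restrict_space borel ?B \<and>
       distr (density_measure ?B \<rho>) (restrict_space lborel ?B) T = restrict_space lborel ?B \<and>
       Lip ?B T \<le> 1 + ennreal C * holder_norm \<alpha> ?B (\<lambda>x. \<rho> x - 1) \<and>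
       Lip ?B (inv_into ?B T) \<le> 1 + ennreal C * holder_norm \<alpha> ?B (\<lambda>x. \<rho> x - 1) \<and>
       (\<exists>T'. continuous_on (closure ?B) T' \<and> (\<forall>x\<in>?B. T' x = T x) \<and> T' ` frontier ?B = frontier ?B)"
    proof (rule exI[of _ T], intro conjI)
      show "bij_betw T ?B ?B"
        by (rule bij_betwI[where g=U]) (auto simp: T_box U_box inv)
      note push_box = distr_density_box[OF \<open>continuous_on ?B \<rho>\<close> g cube_map_continuous[OF T] T_box push]
      show "T \<in> restrict_space borel ?B \<rightarrow>\<^sub>M restrict_space borel ?B"
        by (rule push_box(1))
      show "distr (density_measure ?B \<rho>) (restrict_space lborel ?B) T = restrict_space lborel ?B"
        by (rule push_box(2))
      have "Lip ?B T \<le> ennreal L"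
        using T by (intro Lip_le) (simp add: cube_map_def)
      then show "Lip ?B T \<le> 1 + ennreal C * holder_norm \<alpha> ?B (\<lambda>x. \<rho> x - 1)"
        using L by (rule order_trans)
      have "Lip ?B (inv_into ?B T) \<le> ennreal L"
        using U by (intro Lip_le) (simp add: cube_map_def U_inv)
      then show "Lip ?B (inv_into ?B T) \<le> 1 + ennreal C * holder_norm \<alpha> ?B (\<lambda>x. \<rho> x - 1)"
        using L by (rule order_trans)
      \<comment> \<open>Both \<open>T\<close> and its inverse preserve the closed and the open cube,
        hence their difference, the boundary.\<close>
      have "T ` (?C - ?B) = ?C - ?B"
      proof
        show "T ` (?C - ?B) \<subseteq> ?C - ?B"
          using cube_map_cbox[OF T] T_box by auto
        show "?C - ?B \<subseteq> T ` (?C - ?B)"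
        proof
          fix x
          assume "x \<in> ?C - ?B"
          then have "U x \<in> ?C - ?B"
            using cube_map_cbox[OF U] U_box by auto
          then show "x \<in> T ` (?C - ?B)"
            using inv(2)[of x] by (metis imageI)
        qed
      qed
      \<comment> \<open>\<open>T\<close> is continuous on the whole space and is its own
        extension.\<close>
      then show "\<exists>T'. continuous_on (closure ?B) T' \<and> (\<forall>x\<in>?B. T' x = T x) \<and> T' ` frontier ?B = frontier ?B"
        using cube_map_continuous[OF T] unfolding frontier_box_One by blast
    qed
  qed
qed

end
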